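(* Let $K$ be a compact convex set with $\mathrm{conv}\{0,e_1,\dots,e_d\}\subset K\subset[0,1]^d$. Then the function $$C(u_1,\dots,u_d)=\exp\{-h(K,(-\log u_1,\dots,-\log u_d))\},\quad u\in(0,1]^d,$$ extended by $0$ when some $u_i=0$, is a copula if and only if $K$ is a max-zonoid.
   Context: The support function is $h(K,x)=\sup_{y\in K}\langle y,x\rangle$. A copula is the cumulative distribution function on $[0,1]^d$ of a random vector with uniform $[0,1]$ marginals. Fix a reference norm on $\mathbb{R}^d$ with $\mathbb{S}=\{x\in[0,\infty)^d:\|x\|=1\}$. A compact convex $K\subset[0,\infty)^d$ is a max-zonoid if $h(K,x)=\int_{\mathbb{S}}\max_i(a_ix_i)\,\sigma(da)$ for all $x\in[0,\infty)^d$, for some nonzero finite Borel measure $\sigma$ on $\mathbb{S}$. *)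

theory Defs
  imports "HOL-Probability.Probability"
begin

definition support_fun :: "(real^'n) set \<Rightarrow> real^'n \<Rightarrow> real" where
  "support_fun K x = Sup ((\<lambda>y. y \<bullet> x) ` K)"

definition unit_cube :: "(real^'n) set" where
  "unit_cube = {u. \<forall>i. 0 \<le> u $ i \<and> u $ i \<le> 1}"

definition is_copula :: "(real^'n \<Rightarrow> real) \<Rightarrow> bool" where
  "is_copula C \<longleftrightarrow> (\<exists>P :: (real^'n) measure.
      prob_space P \<and> sets P = sets borel \<and>
      (\<forall>i. distr P borel (\<lambda>x. x $ i) = uniform_measure lborel {0..1}) \<and>
      (\<forall>u \<in> unit_cube. C u = measure P {x. \<forall>i. x $ i \<le> u $ i}))"

definition is_norm_fun :: "(real^'n \<Rightarrow> real) \<Rightarrow> bool" where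
  "is_norm_fun N \<longleftrightarrow>
     (\<forall>x y. N (x + y) \<le> N x + N y) \<and>
     (\<forall>c x. N (c *\<^sub>R x) = \<bar>c\<bar> * N x) \<and>
     (\<forall>x. N x = 0 \<longleftrightarrow> x = 0)"

definition pos_sphere :: "(real^'n \<Rightarrow> real) \<Rightarrow> (real^'n) set" where
  "pos_sphere N = {x. (\<forall>i. 0 \<le> x $ i) \<and> N x = 1}"

definition max_zonoid :: "(real^'n \<Rightarrow> real) \<Rightarrow> (real^'n) set \<Rightarrow> bool" where
  "max_zonoid N K \<longleftrightarrow>
     compact K \<and> convex K \<and> K \<subseteq> {x. \<forall>i. 0 \<le> x $ i} \<and>
     (\<exists>\<sigma> :: (real^'n) measure.
        sets \<sigma> = sets borel \<and> finite_measure \<sigma> \<and>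
        emeasure \<sigma> (UNIV - pos_sphere N) = 0 \<and>
        emeasure \<sigma> (pos_sphere N) \<noteq> 0 \<and>
        (\<forall>x. (\<forall>i. 0 \<le> x $ i) \<longrightarrow>
            integrable \<sigma> (\<lambda>a. Max (range (\<lambda>i. a $ i * x $ i))) \<and>
            support_fun K x = (\<integral>a. Max (range (\<lambda>i. a $ i * x $ i)) \<partial>\<sigma>)))"

end

theory Submission
  imports Defs
begin

text \<open>Put $h = h(K, \cdot)$. If $K$ is a max-zonoid with measure $\sigma$, a vector $X$ with
  $P(X \ge y) = e^{-h(y)}$ is read off a Poisson process: with points $(t, a)$ of intensity
  $dt\,\sigma(da)$, put $X_i = \inf t / a_i$; then $X \ge y$ iff no point lies below the
  graph of $a \mapsto \max_i a_i y_i$, a region of mass $h(y)$. Then $U = e^{-X}$ has distribution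
  function $C$.

  Conversely let $U$ have distribution function $C$ and put $Z_i = 1 / (- \ln U_i)$. By homogeneity of
  $h$, $\max_i y_i Z_i$ has the law of $h(y)$ times a fixed variable with finite $p$-th moments for
  $p < 1$. Tilting by $(\max_i Z_i)^p$ represents $h^p$ by a measure on the directions of $Z$, and a
  weak limit as $p \to 1$ represents $h$.\<close>

section \<open>A space-filling curve with a Borel section\<close>

text \<open>Tilting by the first power is impossible: the fixed variable is standard Frechet, with
  distribution function exp(-1/v), and its mean is infinite. For p < 1 the formula for h^p is exact,
  so the limit only has to repair the exponent. That limit needs compactness. Directions are
  therefore taken relative to the largest coordinate, which puts them into the unit cube whatever
  \<open>N\<close> is; a Borel section of a space-filling curve then carries measures on the cube to
  [0,1]. Only the limit measure is moved to the sphere of \<open>N\<close>. The hypotheses on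
  \<open>K\<close> pin down h on the coordinate axes, h(t e_i) = t, which is what makes the margins
  of C uniform.\<close>

definition wave :: "real \<Rightarrow> real" where
  "wave t = max 0 (min 1 (1/2 - cos (pi * t)))"

lemma wave_bounds: "0 \<le> wave t" "wave t \<le> 1"
  by (auto simp: wave_def)

lemma continuous_on_wave: "continuous_on A (\<lambda>t. wave (c * t))"
  unfolding wave_def by (intro continuous_intros)

text \<open>cos(pi t) is at least 1/2 on the first third of [0,1] and at most -1/2 on the last, so
  shifting by 1/2 and clipping makes \<open>wave\<close> constant on both. These thirds hold the
  reals whose leading ternary digit can be taken as 0 or 2; the period 2 ignores even
  integers.\<close>

lemma wave_digit_0:
  assumes "0 \<le> s" "s \<le> 1/3"
  shows "wave (2 * of_nat m + s) = 0"
proof -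
  have "cos (pi * (2 * real m + s)) = cos (pi * s + real m * (2 * pi))"
    by (simp add: algebra_simps)
  also have "\<dots> = cos (pi * s)"
    using cos.plus_of_nat[of "pi * s" m] by (simp add: mult.commute)
  also have "\<dots> \<ge> cos (pi / 3)"
    using assms by (intro cos_monotone_0_pi_le) (auto simp: field_simps)
  finally show ?thesis
    by (simp add: wave_def cos_60)
qed

lemma wave_digit_1:
  assumes "2/3 \<le> s" "s \<le> 1"
  shows "wave (2 * of_nat m + s) = 1"
proof -
  have "cos (pi * (2 * real m + s)) = cos (pi * s + real m * (2 * pi))"
    by (simp add: algebra_simps)
  also have "\<dots> = cos (pi * s)"
    using cos.plus_of_nat[of "pi * s" m] by (simp add: mult.commute)
  also have "\<dots> \<le> cos (2 * pi / 3)"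
    using assms by (intro cos_monotone_0_pi_le) (auto simp: field_simps)
  finally show ?thesis
    by (simp add: wave_def cos_120)
qed

section \<open>Reading digits off ternary and binary expansions\<close>

lemma summable_ternary: "summable (\<lambda>k. 2 * of_bool (b k) / (3::real) ^ Suc k)"
proof (rule summable_comparison_test')
  show "summable (\<lambda>k. (2/3) * (1/3) ^ k :: real)"
    by (intro summable_mult summable_geometric) auto
qed (auto simp: power_divide field_simps)

lemma ternary_bounds:
  "0 \<le> (\<Sum>k. 2 * of_bool (b k) / (3::real) ^ Suc k)"
  "(\<Sum>k. 2 * of_bool (b k) / (3::real) ^ Suc k) \<le> 1"
proof -
  show "0 \<le> (\<Sum>k. 2 * of_bool (b k) / (3::real) ^ Suc k)"
    by (intro suminf_nonneg summable_ternary) auto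
  have "(\<lambda>k. (2/3) * (1/3) ^ k :: real) sums ((2/3) * (1 / (1 - 1/3)))"
    by (intro sums_mult geometric_sums) auto
  hence s: "(\<lambda>k. (2/3) * (1/3) ^ k :: real) sums 1" by simp
  have "(\<Sum>k. 2 * of_bool (b k) / (3::real) ^ Suc k) \<le> (\<Sum>k. (2/3) * (1/3) ^ k)"
    by (intro suminf_le summable_ternary sums_summable[OF s]) (auto simp: power_divide field_simps)
  also have "\<dots> = 1" using s by (rule sums_unique[symmetric])
  finally show "(\<Sum>k. 2 * of_bool (b k) / (3::real) ^ Suc k) \<le> 1" .
qed

text \<open>Scaling by 3^n turns the digits before place n into an even integer, because every digit
  is 0 or 2, and \<open>wave\<close> has period 2. What remains is a third of digit n plus a tail of
  at most 1/3, so it stays in the third that the digit selects.\<close>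

lemma wave_ternary:
  "wave (3 ^ n * (\<Sum>k. 2 * of_bool (b k) / (3::real) ^ Suc k)) = of_bool (b n)"
proof -
  define f where "f k = 2 * of_bool (b k) / (3::real) ^ Suc k" for k
  define m where "m = (\<Sum>k<n. of_bool (b k) * 3 ^ (n - Suc k) :: nat)"
  define r where "r = (\<Sum>k. 2 * of_bool (b (k + Suc n)) / (3::real) ^ Suc k)"
  have "suminf f = (\<Sum>k. f (k + Suc n)) + (\<Sum>k<Suc n. f k)"
    unfolding f_def by (intro suminf_split_initial_segment summable_ternary)
  also have "(\<Sum>k. f (k + Suc n)) = (1 / 3 ^ Suc n) * r"
    unfolding r_def f_def
    by (subst suminf_mult[symmetric])
      (auto simp: power_add field_simps intro!: summable_ternary[where b="\<lambda>k. b (k + Suc n)", simplified])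
  finally have "3 ^ n * suminf f = r / 3 + 3 ^ n * f n + (\<Sum>k<n. 3 ^ n * f k)"
    by (simp add: sum_distrib_left sum_distrib_right algebra_simps)
  also have "3 ^ n * f n = 2 / 3 * of_bool (b n)"
    by (simp add: f_def)
  also have "(\<Sum>k<n. 3 ^ n * f k) = 2 * real m"
  proof -
    have "3 ^ n * f k = 2 * of_bool (b k) * 3 ^ (n - Suc k)" if "k < n" for k
    proof -
      have "(3::real) ^ n = 3 ^ (n - Suc k) * 3 ^ Suc k"
        using that by (subst power_add[symmetric]) simp
      thus ?thesis by (simp add: f_def)
    qed
    thus ?thesis unfolding m_def of_nat_sum sum_distrib_left by (intro sum.cong) auto
  qed
  finally have eq: "3 ^ n * suminf f = 2 * real m + (2 / 3 * of_bool (b n) + r / 3)"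
    by simp
  have r: "0 \<le> r" "r \<le> 1"
    unfolding r_def by (rule ternary_bounds)+
  have "wave (3 ^ n * suminf f) = of_bool (b n)"
  proof (cases "b n")
    case True
    thus ?thesis using eq r wave_digit_1[of "2/3 + r/3" m] by simp
  next
    case False
    thus ?thesis using eq r wave_digit_0[of "r/3" m] by simp
  qed
  thus ?thesis unfolding f_def .
qed

text \<open>The digits are parities of floors, so the partial sums are exactly the dyadic
  truncations floor(2^n x) / 2^n. The strict bound x < 1 makes the integer part vanish, which is the
  empty partial sum.\<close>

lemma binary_expansion_sums:
  fixes x :: real
  assumes "0 \<le> x" "x < 1"
  shows "(\<lambda>k. of_bool (odd \<lfloor>2 ^ Suc k * x\<rfloor>) * (1/2) ^ Suc k) sums x"
proof -
  have partial: "(\<Sum>k<n. of_bool (odd \<lfloor>2 ^ Suc k * x\<rfloor>) * (1/2) ^ Suc k) = (of_int \<lfloor>2 ^ n * x\<rfloor> / 2 ^ n :: real)" for n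
  proof (induction n)
    case 0
    have "\<lfloor>x\<rfloor> = 0" using assms by (simp add: floor_eq_iff)
    thus ?case by simp
  next
    case (Suc n)
    have "\<lfloor>2 ^ Suc n * x\<rfloor> = 2 * \<lfloor>2 ^ n * x\<rfloor> \<or> \<lfloor>2 ^ Suc n * x\<rfloor> = 2 * \<lfloor>2 ^ n * x\<rfloor> + 1"
      by simp linarith
    hence "\<lfloor>2 ^ Suc n * x\<rfloor> = 2 * \<lfloor>2 ^ n * x\<rfloor> + of_bool (odd \<lfloor>2 ^ Suc n * x\<rfloor>)"
      by auto
    hence "real_of_int \<lfloor>2 ^ Suc n * x\<rfloor> = 2 * of_int \<lfloor>2 ^ n * x\<rfloor> + of_bool (odd \<lfloor>2 ^ Suc n * x\<rfloor>)"
      by (metis (no_types, lifting) of_int_add of_int_mult of_int_numeral of_int_of_bool)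
    thus ?case using Suc by (simp add: field_simps power_divide del: power_Suc) (simp add: field_simps)
  qed
  have "(\<lambda>n. of_int \<lfloor>2 ^ n * x\<rfloor> / 2 ^ n) \<longlonglongrightarrow> x"
  proof (rule tendsto_sandwich)
    show "(\<lambda>n. x - (1/2) ^ n) \<longlonglongrightarrow> x"
      using tendsto_diff[OF tendsto_const LIMSEQ_power_zero[of "1/2::real"], of x] by simp
    show "\<forall>\<^sub>F n in sequentially. x - (1/2) ^ n \<le> of_int \<lfloor>2 ^ n * x\<rfloor> / 2 ^ n"
    proof (intro always_eventually allI)
      fix n
      have "2 ^ n * x - 1 \<le> of_int \<lfloor>2 ^ n * x\<rfloor>" by linarith
      hence "(2 ^ n * x - 1) / 2 ^ n \<le> of_int \<lfloor>2 ^ n * x\<rfloor> / 2 ^ n"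
        by (rule divide_right_mono) simp
      thus "x - (1/2) ^ n \<le> of_int \<lfloor>2 ^ n * x\<rfloor> / 2 ^ n"
        by (simp add: diff_divide_distrib power_divide)
    qed
    show "\<forall>\<^sub>F n in sequentially. of_int \<lfloor>2 ^ n * x\<rfloor> / 2 ^ n \<le> x"
      by (intro always_eventually allI) (simp add: field_simps)
  qed simp
  thus ?thesis unfolding sums_def partial .
qed

text \<open>Schoenberg's space-filling curve: the ternary digits of the parameter are
  distributed over the binary digits of the coordinates.\<close>

lemma space_filling_curve:
  obtains \<phi> :: "real \<Rightarrow> real^'n" where
    "continuous_on UNIV \<phi>"
    "\<And>t i. 0 \<le> \<phi> t $ i" "\<And>t i. \<phi> t $ i \<le> 2"
    "unit_cube \<subseteq> \<phi> ` {0..1}"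
proof -
  define d where "d = CARD('n)"
  obtain j where j: "bij_betw j (UNIV :: 'n set) {0..<d}"
    using ex_bij_betw_finite_nat[of "UNIV :: 'n set"] by (auto simp: d_def)
  have jlt: "j i < d" for i
    using j by (auto simp: bij_betw_def)
  have inj: "inj j" using j by (auto simp: bij_betw_def)
  have dpos: "d > 0" by (simp add: d_def)
  \<comment> \<open>Coordinate \<open>i\<close> owns the ternary places congruent to
    \<open>j i\<close> modulo \<open>d\<close>. The weight 2^-k in place of 2^-(k+1) doubles the
    coordinates, which is why they are bounded by 2 and not by 1.\<close>
  define T where "T i k t = (1/2) ^ k * wave (3 ^ (d * k + j i) * t)" for i k t
  define \<phi> :: "real \<Rightarrow> real^'n" where "\<phi> t = (\<chi> i. \<Sum>k. T i k t)" for t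
  have geo: "(\<lambda>k. (1/2) ^ k :: real) sums 2"
    using geometric_sums[of "1/2::real"] by simp
  have T: "0 \<le> T i k t" "T i k t \<le> (1/2) ^ k" for i k t
    by (auto simp: T_def wave_bounds mult_left_le)
  have sT: "summable (\<lambda>k. T i k t)" for i t
    by (rule summable_comparison_test'[OF sums_summable[OF geo], of 0]) (use T in auto)
  show thesis
  proof
    have "continuous_on UNIV (\<lambda>t. \<Sum>k. T i k t)" for i
    proof (rule uniform_limit_theorem[where F=sequentially and f="\<lambda>n t. \<Sum>k<n. T i k t"])
      show "uniform_limit UNIV (\<lambda>n t. \<Sum>k<n. T i k t) (\<lambda>t. \<Sum>k. T i k t) sequentially"
        by (rule Weierstrass_m_test[where M="\<lambda>k. (1/2) ^ k"])
          (use T sums_summable[OF geo] in auto)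
      show "\<forall>\<^sub>F n in sequentially. continuous_on UNIV (\<lambda>t. \<Sum>k<n. T i k t)"
        unfolding T_def by (intro always_eventually allI continuous_intros continuous_on_wave)
    qed simp
    thus "continuous_on UNIV \<phi>" unfolding \<phi>_def by (intro continuous_on_vec_lambda)
  next
    fix t i
    show "0 \<le> \<phi> t $ i" by (simp add: \<phi>_def suminf_nonneg sT T)
    have "(\<Sum>k. T i k t) \<le> (\<Sum>k. (1/2) ^ k)"
      by (intro suminf_le sT sums_summable[OF geo] T)
    thus "\<phi> t $ i \<le> 2" using sums_unique[OF geo] by (simp add: \<phi>_def)
  next
    show "unit_cube \<subseteq> \<phi> ` {0..1}"
    proof
      fix x :: "real^'n" assume x: "x \<in> unit_cube"
      \<comment> \<open>Interleaves the binary digits of the x_i / 2. Halving brings the value 1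
        below the strict bound of \<open>binary_expansion_sums\<close>, and the doubled weights in
        \<open>T\<close> undo it.\<close>
      define b where "b m = odd \<lfloor>2 ^ Suc (m div d) * (x $ inv j (m mod d) / 2)\<rfloor>" for m
      define t where "t = (\<Sum>k. 2 * of_bool (b k) / (3::real) ^ Suc k)"
      have "\<phi> t $ i = x $ i" for i
      proof -
        have "T i k t = 2 * (of_bool (odd \<lfloor>2 ^ Suc k * (x $ i / 2)\<rfloor>) * (1/2) ^ Suc k)" for k
          unfolding T_def t_def wave_ternary b_def using jlt[of i] dpos inj by (simp add: inv_f_f)
        moreover have "(\<lambda>k. of_bool (odd \<lfloor>2 ^ Suc k * (x $ i / 2)\<rfloor>) * (1/2) ^ Suc k) sums (x $ i / 2)"
        proof (rule binary_expansion_sums)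
          have "0 \<le> x $ i" "x $ i \<le> 1" using x by (auto simp: unit_cube_def)
          thus "0 \<le> x $ i / 2" "x $ i / 2 < 1" by auto
        qed
        ultimately have "(\<lambda>k. T i k t) sums (2 * (x $ i / 2))"
          by (simp only: sums_mult)
        thus ?thesis by (simp add: \<phi>_def sums_iff)
      qed
      hence "x = \<phi> t" by (simp add: vec_eq_iff)
      moreover have "t \<in> {0..1}" using ternary_bounds[of b] by (simp add: t_def)
      ultimately show "x \<in> \<phi> ` {0..1}" by blast
    qed
  qed
qed

text \<open>The least preimage under the curve is lower semicontinuous, hence a Borel section.\<close>

lemma space_filling_curve_section:
  obtains \<phi> :: "real \<Rightarrow> real^'n" and c :: "real^'n \<Rightarrow> real" where
    "continuous_on UNIV \<phi>"
    "\<And>t i. 0 \<le> \<phi> t $ i" "\<And>t i. \<phi> t $ i \<le> 2"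
    "c \<in> borel_measurable borel" "\<And>x. c x \<in> {0..1}"
    "\<And>x. x \<in> unit_cube \<Longrightarrow> \<phi> (c x) = x"
proof -
  obtain \<phi> :: "real \<Rightarrow> real^'n" where \<phi>: "continuous_on UNIV \<phi>"
    "\<And>t i. 0 \<le> \<phi> t $ i" "\<And>t i. \<phi> t $ i \<le> 2" "unit_cube \<subseteq> \<phi> ` {0..1}"
    by (rule space_filling_curve) blast
  define F where "F x = {t\<in>{0..1}. \<phi> t = x}" for x
  define c where "c x = (if x \<in> \<phi> ` {0..1} then Inf (F x) else 0)" for x
  have contA: "continuous_on A \<phi>" for A
    using \<phi>(1) by (rule continuous_on_subset) simp
  have c_in: "c x \<in> F x" if "x \<in> \<phi> ` {0..1}" for x
  proof -
    have "closed (F x)"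
      unfolding F_def by (rule continuous_closed_preimage_constant) (use contA in auto)
    moreover have "F x \<noteq> {}" using that by (auto simp: F_def)
    moreover have "bdd_below (F x)" by (auto simp: F_def intro!: bdd_belowI[of _ 0])
    ultimately show ?thesis using that closed_contains_Inf by (simp add: c_def)
  qed
  have cpt: "compact (\<phi> ` {0..t})" for t
    by (intro compact_continuous_image contA) simp
  \<comment> \<open>The fibres are closed, so the least parameter is attained, and it is at most
    \<open>t\<close> exactly for the points reached by time \<open>t\<close>, a compact set. Points
    off the curve have the default value 0, whence the open complement for t >= 0.\<close>
  have level: "{x. c x \<le> t} = (if t < 0 then {} else - (\<phi> ` {0..1}) \<union> \<phi> ` {0..min 1 t})" for t
  proof -
    have nn: "0 \<le> c x" for x using c_in[of x] by (auto simp: F_def c_def)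
    have "c x \<le> t \<longleftrightarrow> x \<in> \<phi> ` {0..min 1 t}" if "x \<in> \<phi> ` {0..1}" "t \<ge> 0" for x
    proof
      assume "c x \<le> t"
      thus "x \<in> \<phi> ` {0..min 1 t}" using c_in[OF that(1)] by (auto simp: F_def intro!: image_eqI[of _ _ "c x"])
    next
      assume "x \<in> \<phi> ` {0..min 1 t}"
      then obtain s where s: "s \<in> {0..min 1 t}" "x = \<phi> s" by blast
      have "Inf (F x) \<le> s"
        by (rule cInf_lower) (use s in \<open>auto simp: F_def intro!: bdd_belowI[of _ 0]\<close>)
      thus "c x \<le> t" using s that by (simp add: c_def)
    qed
    moreover have "c x \<le> t" if "x \<notin> \<phi> ` {0..1}" "t \<ge> 0" for x
      using that by (simp add: c_def)
    moreover have "\<phi> ` {0..min 1 t} \<subseteq> \<phi> ` {0..1}" by auto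
    ultimately show ?thesis using nn by (cases "t < 0") (auto simp: not_less dest: order_trans[OF nn])
  qed
  have "c \<in> borel_measurable borel"
  proof (rule borel_measurableI_le)
    fix t
    show "{x \<in> space borel. c x \<le> t} \<in> sets borel"
      using level[of t] compact_imp_closed[OF cpt] by (auto intro!: borel_comp borel_closed)
  qed
  moreover have "c x \<in> {0..1}" for x
    using c_in[of x] by (auto simp: F_def c_def)
  moreover have "\<phi> (c x) = x" if "x \<in> unit_cube" for x
    using c_in[of x] that \<phi>(4) by (auto simp: F_def)
  ultimately show thesis using that \<phi> by blast
qed

section \<open>Random vectors from Poisson processes\<close>

text \<open>For nonnegative \<open>a\<close> and \<open>x\<close> this is the support function at
  \<open>x\<close> of the convex hull of 0 and the a_i e_i, the building block of a
  max-zonoid.\<close>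

definition weighted_max :: "real^'n \<Rightarrow> real^'n \<Rightarrow> real" where
  "weighted_max a x = Max (range (\<lambda>i. a $ i * x $ i))"

lemma measurable_vec_nth [measurable]: "(\<lambda>x :: real^'n. x $ i) \<in> borel_measurable borel"
  by (intro borel_measurable_continuous_onI continuous_intros)

lemma measurable_vec_lambda [measurable (raw)]:
  fixes f :: "'n::finite \<Rightarrow> 'a \<Rightarrow> real"
  assumes "\<And>i. f i \<in> borel_measurable M"
  shows "(\<lambda>x. \<chi> i. f i x) \<in> borel_measurable M"
  using assms by (subst borel_measurable_euclidean_space) (auto simp: Basis_vec_def inner_axis)

lemma measurable_weighted_max [measurable]:
  "(\<lambda>a. weighted_max a x) \<in> borel_measurable borel"
  unfolding weighted_max_def by (intro borel_measurable_Max) auto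

lemma weighted_max_le_iff: "weighted_max a x \<le> c \<longleftrightarrow> (\<forall>i. a $ i * x $ i \<le> c)"
  by (simp add: weighted_max_def)

lemma weighted_max_ge: "a $ i * x $ i \<le> weighted_max a x"
  by (simp add: weighted_max_def)

text \<open>Void probability of a Poisson sample: \<open>n\<close> independent points all lie in
  \<open>G\<close> with probability q^n, and the generating function of the Poisson law at q is
  exp(-lam (1 - q)). Infinitely many points are drawn, of which the first \<open>fst z\<close>
  count.\<close>

lemma measure_poisson_iid_all:
  assumes lam: "0 < lam" and "prob_space Q" and G: "G \<in> sets Q"
  defines "B \<equiv> measure_pmf (poisson_pmf lam) \<Otimes>\<^sub>M (\<Pi>\<^sub>M k\<in>(UNIV::nat set). Q)"
  shows "{z \<in> space B. \<forall>k<fst z. snd z k \<in> G} \<in> sets B"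
    and "measure B {z \<in> space B. \<forall>k<fst z. snd z k \<in> G} = exp (- (lam * (1 - measure Q G)))"
proof -
  interpret Q: prob_space Q by fact
  interpret S: product_prob_space "\<lambda>_. Q" "UNIV :: nat set" ..
  define E where "E = {z \<in> space B. \<forall>k<fst z. snd z k \<in> G}"
  have "Measurable.pred B (\<lambda>z. \<forall>k. k < fst z \<longrightarrow> snd z k \<in> G)"
    using G unfolding B_def by measurable
  thus E: "E \<in> sets B" unfolding E_def by (simp add: pred_def)
  define q where "q = measure Q G"
  have q: "0 \<le> q" by (simp add: q_def)
  have slice: "emeasure (\<Pi>\<^sub>M k\<in>(UNIV::nat set). Q) (Pair n -` E) = ennreal (q ^ n)" for n
  proof -
    have "Pair n -` E = prod_emb UNIV (\<lambda>_. Q) {..<n} (\<Pi>\<^sub>E k\<in>{..<n}. G)"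
      using sets.sets_into_space[OF G]
      by (auto simp: E_def B_def space_pair_measure prod_emb_def space_PiM PiE_iff restrict_def extensional_def)
    moreover have "emeasure (\<Pi>\<^sub>M k\<in>(UNIV::nat set). Q) (prod_emb UNIV (\<lambda>_. Q) {..<n} (\<Pi>\<^sub>E k\<in>{..<n}. G))
        = (\<Prod>k\<in>{..<n}. emeasure Q G)"
      using G by (intro S.emeasure_PiM_emb) auto
    ultimately show ?thesis
      by (simp add: Q.emeasure_eq_measure q_def ennreal_power)
  qed
  have "emeasure B E = (\<integral>\<^sup>+n. ennreal (q ^ n) \<partial>measure_pmf (poisson_pmf lam))"
    using E unfolding B_def by (subst S.emeasure_pair_measure_alt) (simp_all add: slice)
  also have "\<dots> = (\<Sum>n. ennreal (lam ^ n / fact n * exp (-lam) * q ^ n))"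
    using lam q by (simp add: nn_integral_measure_pmf nn_integral_count_space_nat flip: ennreal_mult)
  also have "\<dots> = ennreal (exp (- (lam * (1 - q))))"
  proof (rule suminf_ennreal_eq)
    have "(\<lambda>n. exp (-lam) * ((lam * q) ^ n /\<^sub>R fact n)) sums (exp (-lam) * exp (lam * q))"
      by (intro sums_mult exp_converges)
    thus "(\<lambda>n. lam ^ n / fact n * exp (-lam) * q ^ n) sums exp (- (lam * (1 - q)))"
      by (simp add: power_mult_distrib field_simps flip: exp_add)
  qed (use lam q in auto)
  finally show "measure B E = exp (- (lam * (1 - measure Q G)))"
    by (simp add: measure_def q_def)
qed

text \<open>The term for \<open>m\<close> is the length of [0,g] inside [m,m+1]. This adds up what
  the strips of the Poisson process contribute below a graph of height \<open>g\<close>.\<close>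

lemma sum_clamp:
  fixes g :: real
  assumes "0 \<le> g"
  shows "(\<Sum>m<n. max 0 (min 1 (g - real m))) = min g (real n)"
  using assms by (induction n) (auto simp: min_def max_def)

text \<open>Almost surely the absolute value does nothing; it keeps the heights of the points
  nonnegative everywhere, so that bounds on the atoms hold pointwise.\<close>

lemma measure_abs_ge_uniform:
  "measure (uniform_measure lborel {0..1}) {t::real. s \<le> \<bar>t\<bar>} = 1 - max 0 (min 1 s)"
proof -
  have "{0..1} \<inter> {t::real. s \<le> \<bar>t\<bar>} = (if s > 1 then {} else {max 0 s..1})"
    by auto
  thus ?thesis
    by (subst measure_uniform_measure) (auto simp: max_def min_def)
qed

text \<open>The vector realising a given exponent is built from a Poisson process on
  \<open>{0..} \<times> \<real>\<^sup>d\<close> with intensity Lebesgue measure times \<open>\<sigma>\<close>; its restrictions to the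
  strips \<open>{m..m+1} \<times> \<real>\<^sup>d\<close> are independent, and each consists of a Poisson number of
  independent points.\<close>

lemma max_stable_measure:
  fixes \<sigma> :: "(real^'n) measure"
  assumes sets_\<sigma>: "sets \<sigma> = sets borel" and fin: "finite_measure \<sigma>"
    and nz: "emeasure \<sigma> UNIV \<noteq> 0"
    and nonneg: "AE a in \<sigma>. \<forall>i. 0 \<le> a $ i"
    and int: "\<And>y. (\<And>i. 0 \<le> y $ i) \<Longrightarrow> integrable \<sigma> (\<lambda>a. weighted_max a y)"
  obtains P :: "(real^'n) measure" where "prob_space P" "sets P = sets borel"
    "\<And>y. (\<And>i. 0 \<le> y $ i) \<Longrightarrow>
      measure P {x. \<forall>i. x $ i \<le> exp (- (y $ i))} = exp (- (\<integral>a. weighted_max a y \<partial>\<sigma>))"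
proof -
  interpret \<sigma>: finite_measure \<sigma> by fact
  have space_\<sigma>: "space \<sigma> = UNIV" using sets_eq_imp_space_eq[OF sets_\<sigma>] by simp
  note [measurable_cong] = sets_\<sigma>
  define lam where "lam = measure \<sigma> UNIV"
  have lam: "0 < lam"
    using nz by (simp add: lam_def \<sigma>.emeasure_eq_measure zero_less_measure_iff)
  define \<sigma>1 where "\<sigma>1 = density \<sigma> (\<lambda>_. ennreal (1 / lam))"
  have sets_\<sigma>1 [measurable_cong, simp]: "sets \<sigma>1 = sets borel" by (simp add: \<sigma>1_def sets_\<sigma>)
  have space_\<sigma>1 [simp]: "space \<sigma>1 = UNIV" by (simp add: \<sigma>1_def space_\<sigma>)
  interpret \<sigma>1: prob_space \<sigma>1
    by (rule prob_spaceI)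
      (use lam in \<open>simp add: \<sigma>1_def emeasure_density space_\<sigma> \<sigma>.emeasure_eq_measure lam_def flip: ennreal_mult\<close>)
  have integral_\<sigma>1: "(\<integral>a. f a \<partial>\<sigma>1) = (\<integral>a. f a \<partial>\<sigma>) / lam" if "f \<in> borel_measurable borel" for f :: "_ \<Rightarrow> real"
    using that lam unfolding \<sigma>1_def by (subst integral_density) auto
  define U where "U = uniform_measure lborel {0..1::real}"
  have [measurable_cong, simp]: "sets U = sets borel" by (simp add: U_def)
  have [simp]: "space U = UNIV" by (simp add: U_def)
  interpret U: prob_space U unfolding U_def by (rule prob_space_uniform_measure) auto
  define Q where "Q = \<sigma>1 \<Otimes>\<^sub>M U"
  interpret pairQ: pair_prob_space \<sigma>1 U ..
  interpret Q: prob_space Q unfolding Q_def by (rule pairQ.P.prob_space_axioms)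
  have [measurable_cong]: "sets Q = sets (borel \<Otimes>\<^sub>M borel)"
    unfolding Q_def by (intro sets_pair_measure_cong) auto
  have [simp]: "space Q = UNIV" by (simp add: Q_def space_pair_measure)
  define B where "B = measure_pmf (poisson_pmf lam) \<Otimes>\<^sub>M (\<Pi>\<^sub>M k\<in>(UNIV::nat set). Q)"
  interpret S: prob_space "\<Pi>\<^sub>M k\<in>(UNIV::nat set). Q" by (intro prob_space_PiM Q.prob_space_axioms)
  interpret pairB: pair_prob_space "measure_pmf (poisson_pmf lam)" "\<Pi>\<^sub>M k\<in>(UNIV::nat set). Q" ..
  interpret B: prob_space B unfolding B_def by (rule pairB.P.prob_space_axioms)
  have [simp]: "space B = UNIV" by (simp add: B_def space_pair_measure space_PiM)
  interpret \<Omega>: sequence_space B ..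
  have prob_\<Omega>: "prob_space \<Omega>.S" by (intro prob_space_PiM B.prob_space_axioms)
  have meas_num [measurable]: "(\<lambda>w. fst (w m)) \<in> measurable \<Omega>.S (count_space UNIV)" for m
    unfolding B_def by measurable
  have meas_pt [measurable]: "(\<lambda>w. snd (w m) k) \<in> measurable \<Omega>.S (borel \<Otimes>\<^sub>M borel)" for m k
    unfolding B_def by measurable

  \<comment> \<open>A point with mark \<open>a\<close> at height h contributes exp(-h / a_i) to
    coordinate \<open>i\<close>, so the supremum of the atoms is exp of minus the infimum of the h /
    a_i. Absent points and coordinates a_i <= 0 get 0, which stands for an infinite ratio.\<close>
  define atom where "atom i m k w = (if k < fst (w m) \<and> 0 < fst (snd (w m) k) $ i
      then exp (- ((real m + \<bar>snd (snd (w m) k)\<bar>) / fst (snd (w m) k) $ i)) else 0)"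
    for i :: 'n and m k :: nat and w :: "nat \<Rightarrow> nat \<times> (nat \<Rightarrow> (real^'n) \<times> real)"
  have atom_meas [measurable]: "atom i m k \<in> borel_measurable \<Omega>.S" for i m k
    unfolding atom_def by measurable
  have atom_le: "atom i m k w \<le> 1" for i m k w
    by (auto simp: atom_def)
  define X where "X w = (\<chi> i. SUP (m, k). atom i m k w)" for w
  have bdd: "bdd_above (range (\<lambda>(m, k). atom i m k w))" for i w
    using atom_le by (auto intro!: bdd_aboveI[of _ 1])
  have X_meas [measurable]: "X \<in> borel_measurable \<Omega>.S"
    unfolding X_def
  proof (intro measurable_vec_lambda borel_measurable_cSUP)
    show "bdd_above (range (\<lambda>i. case i of (m, k) \<Rightarrow> atom j m k w))" for j w by (rule bdd)
  qed (auto simp: case_prod_unfold)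
  \<comment> \<open>The points of strip \<open>m\<close> on or above the graph of a -> max_i a_i
    y_i; these are the ones compatible with the bound exp(-y).\<close>
  define G where "G y m = {(a, t). weighted_max a y \<le> real m + \<bar>t\<bar>}" for y :: "real^'n" and m :: nat
  have G_meas [measurable]: "G y m \<in> sets Q" for y m
  proof -
    have "Measurable.pred Q (\<lambda>z. weighted_max (fst z) y \<le> real m + \<bar>snd z\<bar>)" by measurable
    thus ?thesis by (simp add: pred_def G_def case_prod_unfold)
  qed
  have atom_iff: "(\<forall>i. atom i m k w \<le> exp (- (y $ i))) \<longleftrightarrow> (k < fst (w m) \<longrightarrow> snd (w m) k \<in> G y m)"
    if y: "\<And>i. 0 \<le> y $ i" for y :: "real^'n" and m k w
  proof (cases "k < fst (w m)")
    case True
    define a where "a = fst (snd (w m) k)"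
    define t where "t = snd (snd (w m) k)"
    have "atom i m k w \<le> exp (- (y $ i)) \<longleftrightarrow> a $ i * y $ i \<le> real m + \<bar>t\<bar>" for i
    proof (cases "0 < a $ i")
      case True
      thus ?thesis using \<open>k < fst (w m)\<close>
        by (simp add: atom_def flip: a_def t_def) (simp add: field_simps)
    next
      case False
      hence "a $ i * y $ i \<le> 0" using y[of i] by (simp add: mult_nonpos_nonneg)
      thus ?thesis using False by (simp add: atom_def flip: a_def t_def) 
    qed
    moreover have "snd (w m) k = (a, t)" by (simp add: a_def t_def)
    ultimately show ?thesis using True by (simp add: G_def weighted_max_le_iff)
  qed (simp add: atom_def)
  have X_iff: "(\<forall>i. X w $ i \<le> exp (- (y $ i))) \<longleftrightarrow> (\<forall>m. \<forall>k<fst (w m). snd (w m) k \<in> G y m)"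
    if y: "\<And>i. 0 \<le> y $ i" for y :: "real^'n" and w
  proof -
    have "(\<forall>i. X w $ i \<le> exp (- (y $ i))) \<longleftrightarrow> (\<forall>m k. \<forall>i. atom i m k w \<le> exp (- (y $ i)))"
      unfolding X_def using bdd by (simp add: cSUP_le_iff) blast
    thus ?thesis using atom_iff[OF y] by simp
  qed
  \<comment> \<open>Over each mark \<open>a\<close> the part of strip \<open>m\<close> below the
    graph has a height clamped to [0,1]. Its mass relative to the mass \<open>lam\<close> of the
    whole strip is the chance that a point violates the bound.\<close>
  have measure_G: "measure Q (G y m) = 1 - (\<integral>a. max 0 (min 1 (weighted_max a y - real m)) \<partial>\<sigma>) / lam" for y m
  proof -
    define f where "f a = max 0 (min 1 (weighted_max a y - real m))" for a
    have [measurable]: "f \<in> borel_measurable borel" unfolding f_def by measurable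
    have f: "0 \<le> f a" "f a \<le> 1" for a by (auto simp: f_def)
    have if1: "integrable \<sigma>1 f"
      by (rule \<sigma>1.integrable_const_bound[where B=1]) (use f in auto)
    have slice: "emeasure U (Pair a -` G y m) = ennreal (1 - f a)" for a
    proof -
      have "Pair a -` G y m = {t. weighted_max a y - real m \<le> \<bar>t\<bar>}" by (auto simp: G_def)
      thus ?thesis
        using measure_abs_ge_uniform[of "weighted_max a y - real m"]
        by (simp add: U.emeasure_eq_measure f_def) (simp add: U_def)
    qed
    have "emeasure Q (G y m) = (\<integral>\<^sup>+a. emeasure U (Pair a -` G y m) \<partial>\<sigma>1)"
      using G_meas unfolding Q_def by (rule U.emeasure_pair_measure_alt)
    also have "\<dots> = (\<integral>\<^sup>+a. ennreal (1 - f a) \<partial>\<sigma>1)"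
      by (simp only: slice)
    also have "\<dots> = ennreal (\<integral>a. 1 - f a \<partial>\<sigma>1)"
      by (rule nn_integral_eq_integral) (use f if1 in auto)
    finally have "measure Q (G y m) = (\<integral>a. 1 - f a \<partial>\<sigma>1)"
      using f by (simp add: Q.emeasure_eq_measure integral_nonneg_AE)
    also have "\<dots> = 1 - (\<integral>a. f a \<partial>\<sigma>1)"
      using if1 by (simp add: \<sigma>1.prob_space[simplified])
    finally show ?thesis by (simp add: integral_\<sigma>1 f_def)
  qed
  have prob_X: "measure \<Omega>.S {w \<in> space \<Omega>.S. \<forall>i. X w $ i \<le> exp (- (y $ i))}
      = exp (- (\<integral>a. weighted_max a y \<partial>\<sigma>))" if y: "\<And>i. 0 \<le> y $ i" for y :: "real^'n"
  proof -
    define E where "E m = {z \<in> space B. \<forall>k<fst z. snd z k \<in> G y m}" for m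
    define f where "f m a = max 0 (min 1 (weighted_max a y - real m))" for m a
    have [measurable]: "f m \<in> borel_measurable borel" for m unfolding f_def by measurable
    have f: "0 \<le> f m a" "f m a \<le> 1" for m a by (auto simp: f_def)
    have f_int: "integrable \<sigma> (f m)" for m
      by (rule \<sigma>.integrable_const_bound[where B=1]) (use f in auto)
    have E_sets: "E m \<in> sets B" for m
      unfolding E_def B_def by (rule measure_poisson_iid_all[OF lam Q.prob_space_axioms G_meas])
    have E_meas: "measure B (E m) = exp (- (\<integral>a. f m a \<partial>\<sigma>))" for m
      unfolding E_def B_def
      by (subst measure_poisson_iid_all[OF lam Q.prob_space_axioms G_meas])
        (use lam in \<open>simp add: measure_G f_def[abs_def]\<close>)
    have set_eq: "{w \<in> space \<Omega>.S. \<forall>i. X w $ i \<le> exp (- (y $ i))} = Pi UNIV E"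
      using X_iff[OF y] by (auto simp: E_def space_PiM Pi_iff)
    \<comment> \<open>Independence of the strips: the probabilities multiply, so the masses below
      the graph add up in the exponent.\<close>
    have "(\<lambda>n. \<Prod>m\<le>n. measure B (E m)) \<longlonglongrightarrow> measure \<Omega>.S (Pi UNIV E)"
      by (rule \<Omega>.measure_PiM_countable[OF E_sets])
    moreover have "(\<Prod>m\<le>n. measure B (E m)) = exp (- (\<integral>a. (\<Sum>m<Suc n. f m a) \<partial>\<sigma>))" for n
      using f_int by (simp add: E_meas exp_sum sum_negf[symmetric] lessThan_Suc_atMost)
    \<comment> \<open>By \<open>sum_clamp\<close> the integrands are the truncations of
      \<open>weighted_max a y\<close> at n + 1, dominated by that integrable function
      itself.\<close>
    moreover have "(\<lambda>n. exp (- (\<integral>a. (\<Sum>m<Suc n. f m a) \<partial>\<sigma>))) \<longlonglongrightarrow> exp (- (\<integral>a. weighted_max a y \<partial>\<sigma>))"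
    proof (intro tendsto_exp tendsto_minus integral_dominated_convergence)
      show "integrable \<sigma> (\<lambda>a. weighted_max a y)" by (rule int[OF y])
      have nn: "AE a in \<sigma>. 0 \<le> weighted_max a y"
        using nonneg
      proof eventually_elim
        case (elim a)
        show ?case using weighted_max_ge[of a undefined y] elim y by (meson mult_nonneg_nonneg order_trans)
      qed
      have eq: "(\<Sum>m<Suc n. f m a) = min (weighted_max a y) (real (Suc n))"
        if "0 \<le> weighted_max a y" for a n
        using sum_clamp[OF that] by (simp only: f_def)
      show "AE a in \<sigma>. norm (\<Sum>m<Suc n. f m a) \<le> weighted_max a y" for n
        using nn
      proof eventually_elim
        case (elim a)
        thus ?case by (simp only: eq) simp
      qed
      show "AE a in \<sigma>. (\<lambda>n. \<Sum>m<Suc n. f m a) \<longlonglongrightarrow> weighted_max a y"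
        using nn
      proof eventually_elim
        case (elim a)
        obtain N :: nat where "weighted_max a y \<le> real N" using real_arch_simple by blast
        hence "\<forall>n\<ge>N. (\<Sum>m<Suc n. f m a) = weighted_max a y"
          by (simp only: eq[OF elim]) (auto simp: min_def)
        thus ?case by (intro tendsto_eventually) (auto simp: eventually_sequentially)
      qed
    qed auto
    ultimately show ?thesis unfolding set_eq using LIMSEQ_unique by auto
  qed
  show thesis
  proof
    show "prob_space (distr \<Omega>.S borel X)" using prob_\<Omega> by (rule prob_space.prob_space_distr) measurable
    fix y :: "real^'n" assume y: "\<And>i. 0 \<le> y $ i"
    have [measurable]: "{x :: real^'n. \<forall>i. x $ i \<le> exp (- (y $ i))} \<in> sets borel"
      by measurable
    show "measure (distr \<Omega>.S borel X) {x. \<forall>i. x $ i \<le> exp (- (y $ i))} = exp (- (\<integral>a. weighted_max a y \<partial>\<sigma>))"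
      using prob_X[OF y] by (subst measure_distr) (auto simp: vimage_def Int_def conj_commute)
  qed simp
qed

section \<open>Weak limits of tilted measures\<close>

lemma continuous_on_Max_range:
  fixes f :: "'i::finite \<Rightarrow> 'a::topological_space \<Rightarrow> real"
  assumes "\<And>i. continuous_on S (f i)"
  shows "continuous_on S (\<lambda>x. Max (range (\<lambda>i. f i x)))"
proof -
  have "continuous_on S (\<lambda>x. Max ((\<lambda>i. f i x) ` I))" if "finite I" "I \<noteq> {}" for I
    using that
  proof (induction I rule: finite_ne_induct)
    case (insert i I)
    thus ?case using assms by (auto intro!: continuous_on_max)
  qed (use assms in auto)
  thus ?thesis by simp
qed

lemma continuous_on_weighted_max: "continuous_on S (\<lambda>a. weighted_max a x)"
  unfolding weighted_max_def by (intro continuous_on_Max_range continuous_intros)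

lemma weighted_max_scaleR:
  assumes "0 \<le> s"
  shows "weighted_max a (s *\<^sub>R x) = s * weighted_max a x"
proof -
  have "s * weighted_max a x = Max ((*) s ` range (\<lambda>i. a $ i * x $ i))"
    unfolding weighted_max_def
    by (rule mono_Max_commute) (use assms in \<open>auto intro!: monoI mult_left_mono\<close>)
  thus ?thesis by (simp add: weighted_max_def image_image mult_ac)
qed

lemma weighted_max_scaleR_left:
  assumes "0 \<le> s"
  shows "weighted_max (s *\<^sub>R a) x = s * weighted_max a x"
proof -
  have "weighted_max (s *\<^sub>R a) x = weighted_max a (s *\<^sub>R x)" by (simp add: weighted_max_def mult_ac)
  thus ?thesis using weighted_max_scaleR[OF assms, of a x] by simp
qed

lemma weighted_max_nonneg:
  assumes "\<And>i. 0 \<le> a $ i" "\<And>i. 0 \<le> x $ i"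
  shows "0 \<le> weighted_max a x"
  using weighted_max_ge[of a undefined x] assms by (meson mult_nonneg_nonneg order_trans)

text \<open>Weighted AM-GM of \<open>s\<close> and 1 gives s^p <= p s + (1 - p). The bound is
  uniform in \<open>s\<close>, as it must be when the exponent and the measure vary
  together.\<close>

lemma powr_near_identity:
  fixes s p :: real
  assumes "0 \<le> s" "s \<le> 1" "0 < p" "p < 1"
  shows "\<bar>s powr p - s\<bar> \<le> 1 - p"
proof (cases "s = 0")
  case False
  hence "0 < s" using assms by simp
  have "s powr p * 1 powr (1 - p) \<le> p * s + (1 - p) * 1"
    using assms \<open>0 < s\<close> by (intro Youngs_inequality_0) auto
  hence "s powr p \<le> p * s + (1 - p)" by simp
  moreover have "p * s \<le> s" using assms by (simp add: mult_left_le_one_le)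
  moreover have "s \<le> s powr p" using assms \<open>0 < s\<close> powr_mono'[of p 1 s] by simp
  ultimately show ?thesis by linarith
qed (use assms in auto)

text \<open>Prokhorov's theorem on the cube is reduced to Helly's selection theorem on the line by
  pulling measures back along a space-filling curve.\<close>

lemma cube_measures_convergent_subsequence:
  fixes \<mu> :: "nat \<Rightarrow> (real^'n) measure"
  assumes "\<And>n. prob_space (\<mu> n)" and sets_\<mu>: "\<And>n. sets (\<mu> n) = sets borel"
    and supp: "\<And>n. AE x in \<mu> n. x \<in> unit_cube"
  obtains r \<nu> where "strict_mono r" "prob_space \<nu>" "sets \<nu> = sets borel"
    "AE a in \<nu>. \<forall>i. 0 \<le> a $ i \<and> a $ i \<le> 2"
    "\<And>f :: real^'n \<Rightarrow> real. continuous_on UNIV f \<Longrightarrow>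
       (\<lambda>n. \<integral>x. f x \<partial>\<mu> (r n)) \<longlonglongrightarrow> (\<integral>x. f x \<partial>\<nu>)"
proof -
  obtain \<phi> :: "real \<Rightarrow> real^'n" and c where \<phi>: "continuous_on UNIV \<phi>"
    "\<And>t i. 0 \<le> \<phi> t $ i" "\<And>t i. \<phi> t $ i \<le> 2"
    and c: "c \<in> borel_measurable borel" "\<And>x. c x \<in> {0..1}"
    and \<phi>c: "\<And>x. x \<in> unit_cube \<Longrightarrow> \<phi> (c x) = x"
    by (rule space_filling_curve_section) blast
  note [measurable] = c(1)
  note [measurable_cong] = sets_\<mu>
  have [measurable]: "\<phi> \<in> borel_measurable borel"
    by (rule borel_measurable_continuous_onI) fact
  define \<kappa> where "\<kappa> n = distr (\<mu> n) borel c" for n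
  have rd: "real_distribution (\<kappa> n)" for n
    using assms(1)[of n] unfolding \<kappa>_def by (rule prob_space.real_distribution_distr) measurable
  \<comment> \<open>Tightness is phrased with intervals open on the left, so the left end lies
    strictly below 0.\<close>
  have "measure (\<kappa> n) {-1<..1} = 1" for n
  proof -
    have "c -` {-1<..1} = UNIV" using c(2) by (force simp: less_le_trans[of "-1" 0])
    thus ?thesis using prob_space.prob_space[OF assms(1)[of n]]
      by (simp add: \<kappa>_def measure_distr)
  qed
  hence "tight \<kappa>"
    unfolding tight_def using rd
    by (intro conjI allI impI exI[of _ "-1"] exI[of _ 1]) auto
  then obtain r K where r: "strict_mono r" "real_distribution K" "weak_conv_m (\<kappa> \<circ> id \<circ> r) K"
    using tight_imp_convergent_subsubsequence[of \<kappa> id] by (auto simp: strict_mono_def)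
  interpret K: real_distribution K by fact
  show thesis
  proof
    show "strict_mono r" by fact
    show "prob_space (distr K borel \<phi>)" by (rule K.prob_space_distr) measurable
    \<comment> \<open>The limit is a pushforward under the curve, so its support is located only
      within the range [0,2]^d of the curve.\<close>
    show "AE a in distr K borel \<phi>. \<forall>i. 0 \<le> a $ i \<and> a $ i \<le> 2"
      using \<phi> by (subst AE_distr_iff) (auto, measurable)
    fix f :: "real^'n \<Rightarrow> real" assume f: "continuous_on UNIV f"
    have [measurable]: "f \<in> borel_measurable borel"
      using f by (rule borel_measurable_continuous_onI)
    have "range \<phi> \<subseteq> cbox 0 (\<chi> i. 2)" using \<phi> by (auto simp: mem_box_cart)
    moreover have "compact (f ` cbox 0 (\<chi> i. 2))"
      by (intro compact_continuous_image continuous_on_subset[OF f]) auto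
    then obtain C where "\<forall>z\<in>f ` cbox 0 (\<chi> i. 2). norm z \<le> C"
      using compact_imp_bounded bounded_iff by metis
    ultimately have C: "norm (f (\<phi> t)) \<le> C" for t by blast
    have cont: "isCont (\<lambda>t. f (\<phi> t)) t" for t
      using continuous_on_compose2[OF f \<phi>(1)] by (simp add: continuous_on_eq_continuous_at)
    \<comment> \<open>The section is merely Borel, so it only moves the measures; test functions are
      pulled back along the continuous curve. On the cube the two maps cancel.\<close>
    have "(\<lambda>n. \<integral>t. f (\<phi> t) \<partial>(\<kappa> \<circ> id \<circ> r) n) \<longlonglongrightarrow> (\<integral>t. f (\<phi> t) \<partial>K)"
      by (rule weak_conv_imp_integral_bdd_continuous_conv[OF _ _ r(3) cont C]) (use rd r in auto)
    moreover have "(\<integral>t. f (\<phi> t) \<partial>(\<kappa> \<circ> id \<circ> r) n) = (\<integral>x. f x \<partial>\<mu> (r n))" for n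
    proof -
      have "(\<integral>t. f (\<phi> t) \<partial>(\<kappa> \<circ> id \<circ> r) n) = (\<integral>x. f (\<phi> (c x)) \<partial>\<mu> (r n))"
        by (simp add: \<kappa>_def integral_distr)
      also have "\<dots> = (\<integral>x. f x \<partial>\<mu> (r n))"
      proof (rule integral_cong_AE)
        show "AE x in \<mu> (r n). f (\<phi> (c x)) = f x"
          using supp by eventually_elim (simp add: \<phi>c)
      qed measurable
      finally show ?thesis .
    qed
    ultimately show "(\<lambda>n. \<integral>x. f x \<partial>\<mu> (r n)) \<longlonglongrightarrow> (\<integral>x. f x \<partial>distr K borel \<phi>)"
      by (simp add: integral_distr)
  qed simp
qed

section \<open>Fractional Frechet moments and tilted measures\<close>

lemma nn_integral_powr_uniform_finite:
  fixes p :: real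
  assumes "p < 1" "0 \<le> p"
  shows "(\<integral>\<^sup>+u. ennreal ((1 / (- ln u)) powr p) \<partial>uniform_measure lborel {0..1}) < \<infinity>"
proof -
  define g where "g x = (if x \<in> {0..1} then x powr (- p) else 0)" for x :: real
  have [measurable]: "g \<in> borel_measurable borel" unfolding g_def by measurable
  have "((\<lambda>x. x powr (- p)) has_integral (1 / (1 - p))) {0..1}"
    using has_integral_powr_from_0[of "- p" 1] assms by simp
  hence "(g has_integral (1 / (1 - p))) UNIV"
    unfolding g_def by (subst has_integral_restrict_UNIV)
  hence I: "(\<integral>\<^sup>+x. ennreal (g x) \<partial>lborel) = ennreal (1 / (1 - p))"
    by (intro nn_integral_has_integral_lborel) (measurable, simp add: g_def)
  have "(\<integral>\<^sup>+u. ennreal ((1 / (- ln u)) powr p) \<partial>uniform_measure lborel {0..1})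
      = (\<integral>\<^sup>+u. ennreal ((1 / (- ln u)) powr p) * indicator {0..1} u \<partial>lborel)"
    by (subst nn_integral_uniform_measure) (auto simp: divide_ennreal_def)
  also have "\<dots> \<le> (\<integral>\<^sup>+u. ennreal (g (1 + (-1) * u)) \<partial>lborel)"
  proof (rule nn_integral_mono_AE)
    have "AE u in lborel. u \<noteq> 0 \<and> u \<noteq> (1::real)"
      using AE_lborel_singleton[of "0::real"] AE_lborel_singleton[of "1::real"] by auto
    thus "AE u in lborel. ennreal ((1 / (- ln u)) powr p) * indicator {0..1} u \<le> ennreal (g (1 + (-1) * u))"
    proof eventually_elim
      case (elim u)
      show ?case
      proof (cases "u \<in> {0..1}")
        case True
        hence u: "0 < u" "u < 1" using elim by auto
        \<comment> \<open>The only singularity is at u = 1, and there the integrand is dominated by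
          (1 - u)^(-p), integrable because p < 1.\<close>
        have "1 - u \<le> - ln u" using ln_le_minus_one[of u] u by simp
        hence "1 / (- ln u) \<le> 1 / (1 - u)" using u by (intro divide_left_mono mult_pos_pos) auto
        hence "(1 / (- ln u)) powr p \<le> (1 / (1 - u)) powr p"
          using u assms by (intro powr_mono2) auto
        also have "\<dots> = (1 - u) powr (- p)"
          using u by (simp add: powr_minus powr_divide inverse_eq_divide)
        finally show ?thesis using u by (simp add: g_def ennreal_leI)
      qed simp
    qed
  qed
  also have "\<dots> = (\<integral>\<^sup>+x. ennreal (g x) \<partial>lborel)"
    using nn_integral_real_affine[of "\<lambda>x. ennreal (g x)" "-1" 1] by simp
  finally show ?thesis using I by (simp add: le_less_trans)
qed

text \<open>With $Z_i = 1 / (- \ln U_i)$, every $\max_i y_i Z_i$ is $h(y)$ times a standard Frechet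
  variable. So the $p$-th moments, $p < 1$, are $h(y)^p$ up to a common factor, which makes
  tilting by $(\max_i Z_i)^p$ turn $h^p$ into an integral over the directions of $Z$.\<close>

lemma tilted_direction_measure:
  fixes P :: "(real^'n) measure" and h :: "real^'n \<Rightarrow> real"
  assumes "prob_space P" and sets_P: "sets P = sets borel"
    and marg: "\<And>i. distr P borel (\<lambda>x. x $ i) = uniform_measure lborel {0..1}"
    and cdf_P: "\<And>y. (\<And>i. 0 \<le> y $ i) \<Longrightarrow> measure P {x. \<forall>i. x $ i \<le> exp (- (y $ i))} = exp (- h y)"
    and hom: "\<And>y t. (\<And>i. 0 \<le> y $ i) \<Longrightarrow> 0 \<le> t \<Longrightarrow> h (t *\<^sub>R y) = t * h y"
    and pos: "\<And>y. (\<And>i. 0 \<le> y $ i) \<Longrightarrow> y \<noteq> 0 \<Longrightarrow> 0 < h y"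
    and p: "0 < p" "p < 1"
  obtains \<mu> :: "(real^'n) measure" where "prob_space \<mu>" "sets \<mu> = sets borel"
    "AE a in \<mu>. a \<in> unit_cube"
    "\<And>y. (\<And>i. 0 \<le> y $ i) \<Longrightarrow> y \<noteq> 0 \<Longrightarrow>
      (\<integral>a. weighted_max a y powr p \<partial>\<mu>) = (h y / h (\<chi> i. 1)) powr p"
proof -
  interpret P: prob_space P by fact
  have [simp]: "space P = UNIV" using sets_eq_imp_space_eq[OF sets_P] by simp
  note [measurable_cong] = sets_P
  define e :: "real^'n" where "e = (\<chi> i. 1)"
  have e: "0 \<le> e $ i" "e \<noteq> 0" for i by (auto simp: e_def vec_eq_iff)
  define Z :: "real^'n \<Rightarrow> real^'n" where "Z x = (\<chi> i. 1 / (- ln (x $ i)))" for x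
  have Z_meas [measurable]: "Z \<in> borel_measurable borel" unfolding Z_def by measurable
  define V where "V y x = weighted_max (Z x) y" for y x
  have V_meas [measurable]: "V y \<in> borel_measurable borel" for y unfolding V_def by measurable
  have AE01: "AE x in P. \<forall>i. 0 < x $ i \<and> x $ i < 1"
  proof (subst AE_all_countable, rule allI)
    fix i
    have "AE t in uniform_measure lborel {0..1}. 0 < t \<and> t < (1::real)"
      using AE_lborel_singleton[of "0::real"] AE_lborel_singleton[of "1::real"]
      by (intro AE_uniform_measureI) auto
    hence "AE t in distr P borel (\<lambda>x. x $ i). 0 < t \<and> t < (1::real)" by (simp only: marg)
    thus "AE x in P. 0 < x $ i \<and> x $ i < 1" by (rule AE_distrD[rotated]) measurable
  qed
  have Z_pos: "0 < Z x $ i" if "\<forall>i. 0 < x $ i \<and> x $ i < 1" for x i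
    using that by (simp add: Z_def divide_pos_neg)
  have V_pos: "0 < V y x" if x: "\<forall>i. 0 < x $ i \<and> x $ i < 1" and y: "\<And>i. 0 \<le> y $ i" "y \<noteq> 0" for x y
  proof -
    obtain i where "y $ i \<noteq> 0" using y(2) by (auto simp: vec_eq_iff)
    hence "0 < Z x $ i * y $ i" using Z_pos[OF x, of i] y(1)[of i] by simp
    thus ?thesis unfolding V_def using weighted_max_ge[of "Z x" i y] by linarith
  qed
  define F where "F y = distr P borel (\<lambda>x. V y x / h y)" for y
  have F_rd: "real_distribution (F y)" for y
    unfolding F_def by (rule P.real_distribution_distr) measurable
  have F_cdf: "cdf (F y) v = (if 0 < v then exp (- (1 / v)) else 0)"
    if y: "\<And>i. 0 \<le> y $ i" "y \<noteq> 0" for y v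
  proof -
    have hy: "0 < h y" using pos y by blast
    have "cdf (F y) v = measure P {x. V y x / h y \<le> v}"
      unfolding cdf_def F_def by (subst measure_distr) (auto simp: vimage_def)
    also have "\<dots> = (if 0 < v then exp (- (1 / v)) else 0)"
    proof (cases "0 < v")
      case True
      \<comment> \<open>V_y <= v h(y) says U_i <= exp(-z_i) for all i, and the scaling makes h(z) =
        1/v by homogeneity. So the law of V_y / h(y) does not depend on \<open>y\<close>.\<close>
      define z where "z = (1 / (v * h y)) *\<^sub>R y"
      have z: "0 \<le> z $ i" for i using True hy y by (simp add: z_def)
      have hz: "h z = 1 / v" using True hy hom[OF y(1), of "1 / (v * h y)"] by (simp add: z_def)
      have "measure P {x. V y x / h y \<le> v} = measure P {x. \<forall>i. x $ i \<le> exp (- (z $ i))}"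
      proof (rule P.finite_measure_eq_AE)
        show "AE x in P. x \<in> {x. V y x / h y \<le> v} \<longleftrightarrow> x \<in> {x. \<forall>i. x $ i \<le> exp (- (z $ i))}"
          using AE01
        proof eventually_elim
          case (elim x)
          have "Z x $ i * y $ i \<le> v * h y \<longleftrightarrow> x $ i \<le> exp (- (z $ i))" for i
          proof -
            have x: "0 < x $ i" "x $ i < 1" using elim by auto
            hence L: "0 < - ln (x $ i)" by simp
            have "Z x $ i * y $ i \<le> v * h y \<longleftrightarrow> y $ i / (- ln (x $ i)) \<le> v * h y"
              by (simp add: Z_def)
            also have "\<dots> \<longleftrightarrow> y $ i \<le> v * h y * (- ln (x $ i))"
              using L by (rule pos_divide_le_eq)
            also have "\<dots> \<longleftrightarrow> z $ i \<le> - ln (x $ i)"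
              using True hy by (simp add: z_def field_simps)
            also have "\<dots> \<longleftrightarrow> ln (x $ i) \<le> - (z $ i)" by linarith
            also have "\<dots> \<longleftrightarrow> x $ i \<le> exp (- (z $ i))" using x exp_le_cancel_iff[of "ln (x $ i)" "- (z $ i)"] by simp
            finally show ?thesis .
          qed
          thus ?case using hy by (simp add: V_def weighted_max_le_iff pos_divide_le_eq)
        qed
      qed measurable
      also have "\<dots> = exp (- (1 / v))" using cdf_P[OF z] hz by simp
      finally show ?thesis using True by simp
    next
      case False
      have "measure P {x. V y x / h y \<le> v} = measure P {}"
      proof (rule P.finite_measure_eq_AE)
        show "AE x in P. x \<in> {x. V y x / h y \<le> v} \<longleftrightarrow> x \<in> {}"
          using AE01
        proof eventually_elim
          case (elim x)
          have "0 < V y x / h y" using V_pos[OF elim y] hy by simp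
          thus ?case using False by simp
        qed
      qed auto
      thus ?thesis using False by simp
    qed
    finally show ?thesis .
  qed
  have F_eq: "F y = F e" if "\<And>i. 0 \<le> y $ i" "y \<noteq> 0" for y
    by (rule cdf_unique[OF F_rd F_rd]) (auto simp: F_cdf that e)
  define m where "m = (\<integral>v. v powr p \<partial>F e)"
  have moment: "(\<integral>x. V y x powr p \<partial>P) = h y powr p * m" if y: "\<And>i. 0 \<le> y $ i" "y \<noteq> 0" for y
  proof -
    have hy: "0 < h y" using pos y by blast
    have "m = (\<integral>x. (V y x / h y) powr p \<partial>P)"
      unfolding m_def F_eq[OF y, symmetric] unfolding F_def by (subst integral_distr) auto
    also have "\<dots> = (\<integral>x. V y x powr p / h y powr p \<partial>P)"
    proof (rule integral_cong_AE)
      show "AE x in P. (V y x / h y) powr p = V y x powr p / h y powr p"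
        using AE01
      proof eventually_elim
        case (elim x)
        thus ?case using V_pos[OF elim y] hy by (simp add: powr_divide)
      qed
    qed measurable
    finally show ?thesis using hy by simp
  qed
  \<comment> \<open>The laws \<open>F y\<close> agree, so one \<open>y\<close> suffices. For y = e_i
    the maximum is the single variable 1 / (- ln U_i), whose moments come from the uniform
    margin.\<close>
  have integrable_F: "integrable (F e) (\<lambda>v. v powr p)"
  proof -
    obtain i :: 'n where True by blast
    define y :: "real^'n" where "y = axis i 1"
    have y: "0 \<le> y $ j" "y \<noteq> 0" for j by (auto simp: y_def axis_def vec_eq_iff)
    have hy: "0 < h y" using pos y by blast
    have V_le: "V y x = 1 / (- ln (x $ i))" if x: "\<forall>i. 0 < x $ i \<and> x $ i < 1" for x
    proof (rule antisym)
      show "V y x \<le> 1 / (- ln (x $ i))"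
        unfolding V_def weighted_max_le_iff using Z_pos[OF x, of i] by (auto simp: y_def axis_def Z_def)
      show "1 / (- ln (x $ i)) \<le> V y x"
        unfolding V_def using weighted_max_ge[of "Z x" i y] by (simp add: y_def Z_def)
    qed
    have "(\<integral>\<^sup>+v. ennreal (norm (v powr p)) \<partial>F y) = (\<integral>\<^sup>+x. ennreal (norm ((V y x / h y) powr p)) \<partial>P)"
      unfolding F_def by (subst nn_integral_distr) auto
    also have "\<dots> = (\<integral>\<^sup>+x. ennreal (1 / h y powr p) * ennreal ((1 / (- ln (x $ i))) powr p) \<partial>P)"
    proof (rule nn_integral_cong_AE)
      show "AE x in P. ennreal (norm ((V y x / h y) powr p))
          = ennreal (1 / h y powr p) * ennreal ((1 / (- ln (x $ i))) powr p)"
        using AE01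
      proof eventually_elim
        case (elim x)
        have "V y x > 0" using V_pos[OF elim y] .
        hence "norm ((V y x / h y) powr p) = 1 / h y powr p * V y x powr p"
          using hy by (simp add: powr_divide)
        thus ?case by (simp add: V_le[OF elim] flip: ennreal_mult)
      qed
    qed
    also have "\<dots> = ennreal (1 / h y powr p) * (\<integral>\<^sup>+x. ennreal ((1 / (- ln (x $ i))) powr p) \<partial>P)"
      by (rule nn_integral_cmult) measurable
    also have "(\<integral>\<^sup>+x. ennreal ((1 / (- ln (x $ i))) powr p) \<partial>P)
        = (\<integral>\<^sup>+u. ennreal ((1 / (- ln u)) powr p) \<partial>uniform_measure lborel {0..1})"
      unfolding marg[of i, symmetric] by (subst nn_integral_distr) auto
    also have "ennreal (1 / h y powr p) * \<dots> < \<infinity>"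
      using nn_integral_powr_uniform_finite[of p] p by (auto simp: ennreal_mult_less_top)
    finally have "integrable (F y) (\<lambda>v. v powr p)"
      by (intro integrableI_bounded) (auto simp: F_def)
    thus ?thesis using F_eq[OF y] by simp
  qed
  have integrable_V: "integrable P (\<lambda>x. V e x powr p)"
  proof -
    have he: "0 < h e" using pos e by blast
    have "integrable P (\<lambda>x. (V e x / h e) powr p)"
      using integrable_F unfolding F_def by (subst (asm) integrable_distr_eq) auto
    hence "integrable P (\<lambda>x. h e powr p * (V e x / h e) powr p)" by simp
    also have "?this \<longleftrightarrow> ?thesis"
    proof (rule integrable_cong_AE)
      show "AE x in P. h e powr p * (V e x / h e) powr p = V e x powr p"
        using AE01
      proof eventually_elim
        case (elim x)
        thus ?case using V_pos[OF elim e] he by (simp add: powr_divide)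
      qed
    qed measurable
    finally show ?thesis .
  qed
  define c where "c = (\<integral>x. V e x powr p \<partial>P)"
  have c: "0 < c"
  proof -
    have V_powr: "AE x in P. V e x powr p > 0"
      using AE01
    proof eventually_elim
      case (elim x)
      thus ?case using V_pos[OF elim e] by simp
    qed
    have "c \<noteq> 0"
    proof
      assume "c = 0"
      hence "AE x in P. V e x powr p = 0"
        unfolding c_def using integrable_V by (subst (asm) integral_nonneg_eq_0_iff_AE) auto
      with V_powr have "AE x in P. False" by eventually_elim simp
      thus False by simp
    qed
    moreover have "0 \<le> c" unfolding c_def by (rule integral_nonneg_AE) auto
    ultimately show ?thesis by simp
  qed
  define D where "D = density P (\<lambda>x. ennreal (V e x powr p / c))"
  \<comment> \<open>\<open>V e\<close> is the largest coordinate of \<open>Z\<close>, so this is the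
    direction of \<open>Z\<close> in the maximum norm, a point of the cube.\<close>
  define A where "A x = (1 / V e x) *\<^sub>R Z x" for x
  have A_meas [measurable]: "A \<in> borel_measurable borel" unfolding A_def by measurable
  have sets_D [measurable_cong]: "sets D = sets borel" by (simp add: D_def sets_P)
  have AE_D: "AE x in D. Q x" if "AE x in P. Q x" for Q
    unfolding D_def using that by (subst AE_density) (measurable, auto)
  interpret D: prob_space D
  proof
    have "emeasure D (space D) = (\<integral>\<^sup>+x. ennreal (V e x powr p / c) \<partial>P)"
      by (simp add: D_def emeasure_density)
    also have "\<dots> = ennreal (\<integral>x. V e x powr p / c \<partial>P)"
      by (rule nn_integral_eq_integral) (use integrable_V c in auto)
    also have "(\<integral>x. V e x powr p / c \<partial>P) = 1" using c by (simp add: c_def)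
    finally show "emeasure D (space D) = 1" by simp
  qed
  show thesis
  proof
    show "prob_space (distr D borel A)" by (rule D.prob_space_distr) measurable
    have [measurable]: "(unit_cube :: (real^'n) set) \<in> sets borel"
      unfolding unit_cube_def by measurable
    have "AE x in D. A x \<in> unit_cube"
      using AE_D[OF AE01]
    proof eventually_elim
      case (elim x)
      have "Z x $ i \<le> V e x" for i
        using weighted_max_ge[of "Z x" i e] by (simp add: V_def e_def)
      thus ?case
        using Z_pos[OF elim] V_pos[OF elim e] by (auto simp: A_def unit_cube_def less_imp_le)
    qed
    thus "AE a in distr D borel A. a \<in> unit_cube"
      by (subst AE_distr_iff) auto
  next
    fix y :: "real^'n" assume y: "\<And>i. 0 \<le> y $ i" "y \<noteq> 0"
    have "(\<integral>a. weighted_max a y powr p \<partial>distr D borel A) = (\<integral>x. weighted_max (A x) y powr p \<partial>D)"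
      by (subst integral_distr) auto
    also have "\<dots> = (\<integral>x. V e x powr p / c * weighted_max (A x) y powr p \<partial>P)"
      unfolding D_def using c by (subst integral_density) auto
    \<comment> \<open>The tilt cancels the normalisation of the direction:
      \<open>weighted_max\<close> is homogeneous, hence V_e^p max_i(A_i y_i)^p = V_y^p.\<close>
    also have "\<dots> = (\<integral>x. V y x powr p / c \<partial>P)"
    proof (rule integral_cong_AE)
      show "AE x in P. V e x powr p / c * weighted_max (A x) y powr p = V y x powr p / c"
        using AE01
      proof eventually_elim
        case (elim x)
        have Ve: "0 < V e x" using V_pos[OF elim e] .
        have "weighted_max (A x) y = V y x / V e x"
          unfolding A_def V_def[of y] using Ve by (subst weighted_max_scaleR_left) auto
        thus ?case using Ve V_pos[OF elim y] by (simp add: powr_divide)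
      qed
    qed measurable
    also have "\<dots> = h y powr p * m / c" by (simp add: moment[OF y])
    also have "c = h e powr p * m" unfolding c_def by (rule moment[OF e])
    also have "h y powr p * m / (h e powr p * m) = (h y / h e) powr p"
    proof -
      have "m \<noteq> 0" using c moment[OF e] by (auto simp: c_def)
      thus ?thesis using pos[OF y] pos[OF e] by (simp add: powr_divide)
    qed
    finally show "(\<integral>a. weighted_max a y powr p \<partial>distr D borel A) = (h y / h (\<chi> i. 1)) powr p"
      by (simp add: e_def)
  qed simp
qed

text \<open>Along exponents p_n tending to 1 the tilted measures live on the compact cube and have a
  weak limit. Replacing the p_n-th power of the integrand by the integrand costs at most 1 - p_n, so
  the limit represents h(y) / h(1,...,1).\<close>

lemma spectral_measure_of_copula:
  fixes P :: "(real^'n) measure" and h :: "real^'n \<Rightarrow> real"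
  assumes "prob_space P" and "sets P = sets borel"
    and "\<And>i. distr P borel (\<lambda>x. x $ i) = uniform_measure lborel {0..1}"
    and "\<And>y. (\<And>i. 0 \<le> y $ i) \<Longrightarrow> measure P {x. \<forall>i. x $ i \<le> exp (- (y $ i))} = exp (- h y)"
    and hom: "\<And>y t. (\<And>i. 0 \<le> y $ i) \<Longrightarrow> 0 \<le> t \<Longrightarrow> h (t *\<^sub>R y) = t * h y"
    and pos: "\<And>y. (\<And>i. 0 \<le> y $ i) \<Longrightarrow> y \<noteq> 0 \<Longrightarrow> 0 < h y"
  obtains \<nu> :: "(real^'n) measure" where "prob_space \<nu>" "sets \<nu> = sets borel"
    "AE a in \<nu>. \<forall>i. 0 \<le> a $ i \<and> a $ i \<le> 2"
    "\<And>y. (\<And>i. 0 \<le> y $ i) \<Longrightarrow> h y = h (\<chi> i. 1) * (\<integral>a. weighted_max a y \<partial>\<nu>)"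
proof -
  define e :: "real^'n" where "e = (\<chi> i. 1)"
  have he: "0 < h e" by (rule pos) (auto simp: e_def vec_eq_iff)
  \<comment> \<open>The shift by 2 keeps p_0 = 1/2 strictly positive.\<close>
  define p where "p n = 1 - 1 / (real n + 2)" for n
  have p: "0 < p n" "p n < 1" for n by (auto simp: p_def)
  have p_lim: "p \<longlonglongrightarrow> 1"
  proof -
    have "(\<lambda>n. 1 / real (n + 2)) \<longlonglongrightarrow> 0" by (rule LIMSEQ_ignore_initial_segment[OF lim_1_over_n])
    from tendsto_diff[OF tendsto_const[of 1] this] show ?thesis by (simp add: p_def[abs_def] add.commute)
  qed
  have "\<exists>\<mu> :: (real^'n) measure. prob_space \<mu> \<and> sets \<mu> = sets borel \<and> (AE a in \<mu>. a \<in> unit_cube) \<and>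
      (\<forall>y. (\<forall>i. 0 \<le> y $ i) \<longrightarrow> y \<noteq> 0 \<longrightarrow>
        (\<integral>a. weighted_max a y powr p n \<partial>\<mu>) = (h y / h e) powr p n)" for n
    unfolding e_def using tilted_direction_measure[OF assms p[of n]] by metis
  then obtain \<mu> :: "nat \<Rightarrow> (real^'n) measure" where \<mu>: "\<And>n. prob_space (\<mu> n)"
    "\<And>n. sets (\<mu> n) = sets borel" "\<And>n. AE a in \<mu> n. a \<in> unit_cube"
    "\<And>n y. (\<And>i. 0 \<le> y $ i) \<Longrightarrow> y \<noteq> 0 \<Longrightarrow>
        (\<integral>a. weighted_max a y powr p n \<partial>\<mu> n) = (h y / h e) powr p n"
    by metis
  obtain r \<nu> where r: "strict_mono r" and \<nu>: "prob_space \<nu>" "sets \<nu> = sets borel"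
    "AE a in \<nu>. \<forall>i. 0 \<le> a $ i \<and> a $ i \<le> 2"
    and conv: "\<And>f :: real^'n \<Rightarrow> real. continuous_on UNIV f \<Longrightarrow>
       (\<lambda>n. \<integral>x. f x \<partial>\<mu> (r n)) \<longlonglongrightarrow> (\<integral>x. f x \<partial>\<nu>)"
    by (rule cube_measures_convergent_subsequence[of \<mu>, OF \<mu>(1-3)]) blast
  \<comment> \<open>Coordinates at most 1 keep \<open>weighted_max a y\<close> in [0,1] on the cube,
    where \<open>powr_near_identity\<close> applies. Homogeneity of both sides extends the identity
    afterwards.\<close>
  have small: "h y = h e * (\<integral>a. weighted_max a y \<partial>\<nu>)"
    if y: "\<And>i. 0 \<le> y $ i" "\<And>i. y $ i \<le> 1" "y \<noteq> 0" for y
  proof -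
    define I where "I n = (\<integral>a. weighted_max a y \<partial>\<mu> n)" for n
    have near: "\<bar>(h y / h e) powr p n - I n\<bar> \<le> 1 - p n" for n
    proof -
      interpret prob_space "\<mu> n" by (rule \<mu>)
      note [measurable_cong] = \<mu>(2)[of n]
      have wm: "AE a in \<mu> n. 0 \<le> weighted_max a y \<and> weighted_max a y \<le> 1"
        using \<mu>(3)[of n]
      proof eventually_elim
        case (elim a)
        hence a: "0 \<le> a $ i" "a $ i \<le> 1" for i by (auto simp: unit_cube_def)
        thus ?case using weighted_max_nonneg[OF a(1) y(1)] y
          by (auto simp: weighted_max_le_iff intro!: mult_le_one)
      qed
      have i1: "integrable (\<mu> n) (\<lambda>a. weighted_max a y)"
        by (rule integrable_const_bound[where B=1]) (use wm in auto)
      have i2: "integrable (\<mu> n) (\<lambda>a. weighted_max a y powr p n)"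
      proof (rule integrable_const_bound[where B=1])
        show "AE a in \<mu> n. norm (weighted_max a y powr p n) \<le> 1"
          using wm by eventually_elim (use p[of n] in \<open>auto intro!: powr_le1\<close>)
      qed measurable
      have "(h y / h e) powr p n - I n = (\<integral>a. weighted_max a y powr p n - weighted_max a y \<partial>\<mu> n)"
        using i1 i2 \<mu>(4)[OF y(1,3), of n] by (simp add: I_def)
      also have "\<bar>\<dots>\<bar> \<le> (\<integral>a. \<bar>weighted_max a y powr p n - weighted_max a y\<bar> \<partial>\<mu> n)"
        by (rule integral_abs_bound)
      also have "\<dots> \<le> (\<integral>a. 1 - p n \<partial>\<mu> n)"
      proof (rule integral_mono_AE)
        show "AE a in \<mu> n. \<bar>weighted_max a y powr p n - weighted_max a y\<bar> \<le> 1 - p n"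
          using wm by eventually_elim (use p[of n] in \<open>auto intro!: powr_near_identity\<close>)
      qed (use i1 i2 in auto)
      also have "\<dots> = 1 - p n" by (simp add: prob_space)
      finally show ?thesis .
    qed
    have "(\<lambda>n. (h y / h e) powr p n - I n) \<longlonglongrightarrow> 0"
    proof (rule Lim_null_comparison)
      show "(\<lambda>n. 1 - p n) \<longlonglongrightarrow> 0" using tendsto_diff[OF tendsto_const[of 1] p_lim] by simp
      show "\<forall>\<^sub>F n in sequentially. norm ((h y / h e) powr p n - I n) \<le> 1 - p n"
        using near by simp
    qed
    moreover have "(\<lambda>n. (h y / h e) powr p n) \<longlonglongrightarrow> (h y / h e) powr 1"
      by (intro tendsto_powr tendsto_const p_lim) (use he pos[OF y(1,3)] in auto)
    ultimately have "(\<lambda>n. (h y / h e) powr p n - ((h y / h e) powr p n - I n)) \<longlonglongrightarrow> (h y / h e) powr 1 - 0"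
      by (rule tendsto_diff[rotated])
    hence "I \<longlonglongrightarrow> h y / h e" using he pos[OF y(1,3)] by simp
    hence "(\<lambda>n. I (r n)) \<longlonglongrightarrow> h y / h e"
      using LIMSEQ_subseq_LIMSEQ[OF _ r] by (auto simp: o_def)
    moreover have "(\<lambda>n. I (r n)) \<longlonglongrightarrow> (\<integral>a. weighted_max a y \<partial>\<nu>)"
      unfolding I_def by (intro conv continuous_on_weighted_max)
    ultimately have "h y / h e = (\<integral>a. weighted_max a y \<partial>\<nu>)" by (rule LIMSEQ_unique)
    thus ?thesis using he by (simp add: field_simps)
  qed
  have all: "h y = h e * (\<integral>a. weighted_max a y \<partial>\<nu>)" if y: "\<And>i. 0 \<le> y $ i" for y
  proof (cases "y = 0")
    case True
    have "h (0 *\<^sub>R y) = 0 * h y" by (rule hom) (use y in auto)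
    moreover have "weighted_max a 0 = 0" for a :: "real^'n"
      using weighted_max_scaleR[of 0 a 0] by simp
    ultimately show ?thesis using True by simp
  next
    case False
    hence n: "0 < norm y" by simp
    define z where "z = (1 / norm y) *\<^sub>R y"
    have z: "0 \<le> z $ i" "z $ i \<le> 1" "z \<noteq> 0" for i
      using y n False component_le_norm_cart[of y i] by (auto simp: z_def)
    have yz: "y = norm y *\<^sub>R z" using n by (simp add: z_def)
    have "h y = norm y * h z" using hom[OF z(1), of "norm y"] yz by simp
    also have "\<dots> = h e * (norm y * (\<integral>a. weighted_max a z \<partial>\<nu>))"
      using small[OF z] by simp
    also have "norm y * (\<integral>a. weighted_max a z \<partial>\<nu>) = (\<integral>a. weighted_max a (norm y *\<^sub>R z) \<partial>\<nu>)"
      by (simp only: weighted_max_scaleR[OF norm_ge_zero] integral_mult_right_zero)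
    finally show ?thesis using yz by simp
  qed
  show thesis by (rule that[OF \<nu>]) (rule all[unfolded e_def])
qed

section \<open>Max-zonoids and copulas\<close>

text \<open>The triangle inequality for x and -x gives 0 = N(0) <= 2 N(x).\<close>

lemma norm_fun_nonneg:
  assumes "is_norm_fun N"
  shows "0 \<le> N x"
proof -
  have "N (x + (- 1) *\<^sub>R x) \<le> N x + N ((- 1) *\<^sub>R x)" "N ((- 1) *\<^sub>R x) = \<bar>- 1\<bar> * N x" "N 0 = 0"
    using assms unfolding is_norm_fun_def by blast+
  thus ?thesis by simp
qed

text \<open>A finite convex function on a finite-dimensional space is continuous. This makes the
  sphere of \<open>N\<close> Borel and bounds \<open>N\<close> on compact boxes.\<close>

lemma norm_fun_continuous:
  fixes N :: "real^'n \<Rightarrow> real"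
  assumes "is_norm_fun N"
  shows "continuous_on UNIV N"
proof (rule convex_on_continuous)
  show "convex_on UNIV N"
  proof (rule convex_onI)
    fix t :: real and x y :: "real^'n"
    assume t: "0 < t" "t < 1"
    have "N ((1 - t) *\<^sub>R x + t *\<^sub>R y) \<le> N ((1 - t) *\<^sub>R x) + N (t *\<^sub>R y)"
      "N ((1 - t) *\<^sub>R x) = \<bar>1 - t\<bar> * N x" "N (t *\<^sub>R y) = \<bar>t\<bar> * N y"
      using assms unfolding is_norm_fun_def by blast+
    thus "N ((1 - t) *\<^sub>R x + t *\<^sub>R y) \<le> (1 - t) * N x + t * N y" using t by simp
  qed simp
qed simp

text \<open>Polar decomposition with respect to \<open>N\<close>: a measure on the cube is moved to the sphere of
  \<open>N\<close> along rays, with weight \<open>N\<close>.\<close>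

lemma spectral_measure_on_sphere:
  fixes \<nu> :: "(real^'n) measure" and N :: "real^'n \<Rightarrow> real"
  assumes N: "is_norm_fun N" and "prob_space \<nu>" and sets_\<nu>: "sets \<nu> = sets borel"
    and supp: "AE a in \<nu>. \<forall>i. 0 \<le> a $ i \<and> a $ i \<le> 2" and c: "0 < c"
  obtains \<sigma> :: "(real^'n) measure" where "sets \<sigma> = sets borel" "finite_measure \<sigma>"
    "AE a in \<sigma>. a \<in> pos_sphere N"
    "\<And>y. (\<And>i. 0 \<le> y $ i) \<Longrightarrow> integrable \<sigma> (\<lambda>a. weighted_max a y)"
    "\<And>y. (\<integral>a. weighted_max a y \<partial>\<sigma>) = c * (\<integral>a. weighted_max a y \<partial>\<nu>)"
proof -
  interpret \<nu>: prob_space \<nu> by fact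
  note [measurable_cong] = sets_\<nu>
  have [simp]: "space \<nu> = UNIV" using sets_eq_imp_space_eq[OF sets_\<nu>] by simp
  have N_meas [measurable]: "N \<in> borel_measurable borel"
    by (rule borel_measurable_continuous_onI) (rule norm_fun_continuous[OF N])
  have N_pos: "0 < N a" if "a \<noteq> 0" for a
    using norm_fun_nonneg[OF N, of a] N that unfolding is_norm_fun_def by (metis less_eq_real_def)
  have N0: "N 0 = 0" using N unfolding is_norm_fun_def by blast
  have "compact (N ` cbox 0 (\<chi> i. 2))"
    by (intro compact_continuous_image continuous_on_subset[OF norm_fun_continuous[OF N]]) auto
  then obtain M where M: "\<forall>z\<in>N ` cbox 0 (\<chi> i. 2). norm z \<le> M"
    using compact_imp_bounded bounded_iff by metis
  have N_le: "AE a in \<nu>. N a \<le> M"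
    using supp
  proof eventually_elim
    case (elim a)
    hence "a \<in> cbox 0 (\<chi> i. 2)" by (simp add: mem_box_cart)
    thus ?case using M by (metis abs_le_D1 imageI real_norm_def)
  qed
  \<comment> \<open>The weight \<open>N\<close> compensates the division by \<open>N\<close> in
    \<open>g\<close>, since \<open>weighted_max\<close> is homogeneous in \<open>a\<close>. It also
    removes any mass at the origin, which has no direction.\<close>
  define D where "D = density \<nu> (\<lambda>a. ennreal (c * N a))"
  define g where "g a = (1 / N a) *\<^sub>R a" for a
  have [measurable]: "g \<in> borel_measurable borel" unfolding g_def by measurable
  have [measurable_cong]: "sets D = sets borel" by (simp add: D_def sets_\<nu>)
  have N_int: "integrable \<nu> (\<lambda>a. c * N a)"
  proof (rule \<nu>.integrable_const_bound[where B="c * M"])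
    show "AE a in \<nu>. norm (c * N a) \<le> c * M"
      using N_le by eventually_elim (use c norm_fun_nonneg[OF N] in \<open>simp add: abs_mult\<close>)
  qed measurable
  have emD: "emeasure D UNIV = ennreal (\<integral>a. c * N a \<partial>\<nu>)"
    unfolding D_def using N_int c norm_fun_nonneg[OF N]
    by (simp add: emeasure_density nn_integral_eq_integral)
  have D_fin: "finite_measure D"
    by (rule finite_measureI) (simp add: emD D_def[THEN arg_cong[of _ _ space]])
  show thesis
  proof
    show "finite_measure (distr D borel g)"
      using D_fin by (rule finite_measure.finite_measure_distr) measurable
    have [measurable]: "pos_sphere N \<in> sets borel"
      unfolding pos_sphere_def by measurable
    have "AE a in D. g a \<in> pos_sphere N"
      unfolding D_def
    proof (subst AE_density)
      show "AE a in \<nu>. 0 < ennreal (c * N a) \<longrightarrow> g a \<in> pos_sphere N"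
        using supp
      proof eventually_elim
        case (elim a)
        show ?case
        proof
          assume "0 < ennreal (c * N a)"
          hence Na: "0 < N a" using c by (simp add: zero_less_mult_iff)
          have "N (g a) = \<bar>1 / N a\<bar> * N a" unfolding g_def using N unfolding is_norm_fun_def by blast
          thus "g a \<in> pos_sphere N" using Na elim by (simp add: pos_sphere_def g_def)
        qed
      qed
    qed measurable
    thus "AE a in distr D borel g. a \<in> pos_sphere N"
      by (subst AE_distr_iff) auto
    have rescale: "c * N a * weighted_max (g a) y = c * weighted_max a y" for a y
    proof (cases "a = 0")
      case True
      have "weighted_max 0 y = 0" using weighted_max_scaleR_left[of 0 0 y] by simp
      thus ?thesis using True by (simp add: N0)
    next
      case False
      thus ?thesis using N_pos[OF False] by (simp add: g_def weighted_max_scaleR_left)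
    qed
    fix y :: "real^'n"
    show "(\<integral>a. weighted_max a y \<partial>distr D borel g) = c * (\<integral>a. weighted_max a y \<partial>\<nu>)"
      unfolding D_def using c norm_fun_nonneg[OF N]
      by (subst integral_distr, measurable, subst integral_density) (auto simp: rescale)
    assume y: "\<And>i. 0 \<le> y $ i"
    have "integrable \<nu> (\<lambda>a. c * weighted_max a y)"
    proof (rule \<nu>.integrable_const_bound[where B="c * weighted_max (\<chi> i. 2) y"])
      show "AE a in \<nu>. norm (c * weighted_max a y) \<le> c * weighted_max (\<chi> i. 2) y"
        using supp
      proof eventually_elim
        case (elim a)
        have "a $ i * y $ i \<le> weighted_max (\<chi> i. 2) y" for i
        proof -
          have "a $ i * y $ i \<le> 2 * y $ i" using elim y by (intro mult_right_mono) auto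
          also have "\<dots> \<le> weighted_max (\<chi> i. 2) y"
            using weighted_max_ge[of "\<chi> i. 2" i y] by simp
          finally show ?thesis .
        qed
        hence "weighted_max a y \<le> weighted_max (\<chi> i. 2) y" by (simp add: weighted_max_le_iff)
        thus ?case using c weighted_max_nonneg[of a y] elim y by (simp add: abs_mult)
      qed
    qed measurable
    thus "integrable (distr D borel g) (\<lambda>a. weighted_max a y)"
      unfolding D_def using c norm_fun_nonneg[OF N]
      by (subst integrable_distr_eq, measurable, subst integrable_density) (auto simp: rescale)
  qed simp
qed

section \<open>Support functions of sets between the simplex and the cube\<close>

context
  fixes K :: "(real^'n) set"
  assumes hull: "convex hull (insert 0 (range (\<lambda>i. axis i 1))) \<subseteq> K"
    and cube: "K \<subseteq> unit_cube"
begin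

lemma inner_le_sum:
  assumes "y \<in> K" "\<And>i. 0 \<le> x $ i"
  shows "y \<bullet> x \<le> (\<Sum>i\<in>UNIV. x $ i)"
  unfolding inner_vec_def
  using assms cube by (intro sum_mono) (auto simp: unit_cube_def subset_iff mult_left_le_one_le)

lemma bdd_above_inner:
  assumes "\<And>i. 0 \<le> x $ i"
  shows "bdd_above ((\<lambda>y. y \<bullet> x) ` K)"
  using inner_le_sum assms by (auto intro!: bdd_aboveI)

lemma axis_in_K: "axis i 1 \<in> K"
  using hull hull_inc[of "axis i 1" "insert 0 (range (\<lambda>i. axis i 1))" convex] by blast

lemma K_nonempty: "K \<noteq> {}"
  using axis_in_K by blast

lemma support_fun_ge:
  assumes "\<And>i. 0 \<le> x $ i"
  shows "x $ i \<le> support_fun K x"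
proof -
  have "axis i 1 \<bullet> x \<le> support_fun K x"
    unfolding support_fun_def by (rule cSUP_upper[OF axis_in_K bdd_above_inner[OF assms]])
  thus ?thesis by (simp add: inner_commute[of "axis i 1"] inner_axis)
qed

lemma support_fun_le_sum:
  assumes "\<And>i. 0 \<le> x $ i"
  shows "support_fun K x \<le> (\<Sum>i\<in>UNIV. x $ i)"
  unfolding support_fun_def
  by (rule cSUP_least[OF K_nonempty]) (use inner_le_sum assms in auto)

text \<open>On an axis the lower bound from the unit vectors in \<open>K\<close> meets the upper
  bound from the cube. This gives C its uniform margins.\<close>

lemma support_fun_axis:
  assumes "0 \<le> t"
  shows "support_fun K (axis i t) = t"
proof (rule antisym)
  have x: "0 \<le> axis i t $ j" for j using assms by (simp add: axis_def)
  show "support_fun K (axis i t) \<le> t"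
    using support_fun_le_sum[OF x] by (simp add: axis_def)
  show "t \<le> support_fun K (axis i t)"
    using support_fun_ge[OF x, of i] by simp
qed

lemma support_fun_scaleR:
  assumes "\<And>i. 0 \<le> x $ i" "0 \<le> t"
  shows "support_fun K (t *\<^sub>R x) = t * support_fun K x"
proof (cases "t = 0")
  case True
  thus ?thesis using K_nonempty by (simp add: support_fun_def image_constant_conv)
next
  case False
  hence t: "0 < t" using assms by simp
  have tx: "0 \<le> (t *\<^sub>R x) $ i" for i using assms by simp
  show ?thesis
  proof (rule antisym)
    show "support_fun K (t *\<^sub>R x) \<le> t * support_fun K x"
      unfolding support_fun_def[of K "t *\<^sub>R x"]
    proof (rule cSUP_least[OF K_nonempty])
      fix y assume "y \<in> K"
      hence "y \<bullet> x \<le> support_fun K x"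
        unfolding support_fun_def by (rule cSUP_upper) (rule bdd_above_inner[OF assms(1)])
      thus "y \<bullet> t *\<^sub>R x \<le> t * support_fun K x" using t by simp
    qed
    have "support_fun K x \<le> support_fun K (t *\<^sub>R x) / t"
      unfolding support_fun_def[of K x]
    proof (rule cSUP_least[OF K_nonempty])
      fix y assume "y \<in> K"
      hence "y \<bullet> t *\<^sub>R x \<le> support_fun K (t *\<^sub>R x)"
        unfolding support_fun_def by (rule cSUP_upper) (rule bdd_above_inner[OF tx])
      thus "y \<bullet> x \<le> support_fun K (t *\<^sub>R x) / t" using t by (simp add: field_simps)
    qed
    thus "t * support_fun K x \<le> support_fun K (t *\<^sub>R x)" using t by (simp add: field_simps)
  qed
qed

lemma support_fun_pos:
  assumes "\<And>i. 0 \<le> x $ i" "x \<noteq> 0"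
  shows "0 < support_fun K x"
proof -
  obtain i where "x $ i \<noteq> 0" using assms(2) by (auto simp: vec_eq_iff)
  thus ?thesis using support_fun_ge[OF assms(1), of i] assms(1)[of i] by linarith
qed

end

text \<open>The Poisson construction fixes the distribution function only at corners in (0,1]^d. The
  corner (1,...,1) confines the vector to coordinates at most 1, corners on the edges give the
  margins, and these dispose of the corners with a zero coordinate.\<close>

lemma copula_of_max_zonoid:
  fixes K :: "(real^'n) set"
  assumes K: "convex hull (insert 0 (range (\<lambda>i. axis i 1))) \<subseteq> K" "K \<subseteq> unit_cube"
    and "max_zonoid N K"
  shows "is_copula (\<lambda>u. if (\<exists>i. u $ i = 0) then 0
                        else exp (- support_fun K (\<chi> i. - ln (u $ i))))"
proof -
  define h where "h = support_fun K"
  obtain \<sigma> :: "(real^'n) measure" where \<sigma>: "sets \<sigma> = sets borel" "finite_measure \<sigma>"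
    "emeasure \<sigma> (UNIV - pos_sphere N) = 0" "emeasure \<sigma> (pos_sphere N) \<noteq> 0"
    and rep: "\<And>x. (\<And>i. 0 \<le> x $ i) \<Longrightarrow>
            integrable \<sigma> (\<lambda>a. weighted_max a x) \<and> h x = (\<integral>a. weighted_max a x \<partial>\<sigma>)"
    using assms(3) unfolding max_zonoid_def weighted_max_def h_def by blast
  \<comment> \<open>Nonmeasurable sets have \<open>emeasure\<close> 0, so a nonzero value certifies
    measurability.\<close>
  have sphere: "pos_sphere N \<in> sets \<sigma>"
    using \<sigma>(4) emeasure_notin_sets by blast
  have "emeasure \<sigma> (pos_sphere N) \<le> emeasure \<sigma> UNIV"
    by (rule emeasure_mono) (auto simp: \<sigma>)
  hence nz: "emeasure \<sigma> UNIV \<noteq> 0" using \<sigma>(4) by auto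
  have nonneg: "AE a in \<sigma>. \<forall>i. 0 \<le> a $ i"
  proof (rule AE_I')
    show "UNIV - pos_sphere N \<in> null_sets \<sigma>"
      using sphere \<sigma>(3) sets.compl_sets[OF sphere] sets_eq_imp_space_eq[OF \<sigma>(1)]
      by (auto intro!: null_setsI)
  qed (auto simp: pos_sphere_def)
  obtain P :: "(real^'n) measure" where P: "prob_space P" "sets P = sets borel"
    and cdf_P: "\<And>y. (\<And>i. 0 \<le> y $ i) \<Longrightarrow>
      measure P {x. \<forall>i. x $ i \<le> exp (- (y $ i))} = exp (- (\<integral>a. weighted_max a y \<partial>\<sigma>))"
    by (rule max_stable_measure[OF \<sigma>(1,2) nz nonneg]) (use rep in blast)+
  interpret P: prob_space P by fact
  note [measurable_cong] = P(2)
  have [simp]: "space P = UNIV" using sets_eq_imp_space_eq[OF P(2)] by simp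
  have C: "measure P {x. \<forall>i. x $ i \<le> u $ i} = exp (- h (\<chi> i. - ln (u $ i)))"
    if u: "\<And>i. 0 < u $ i" "\<And>i. u $ i \<le> 1" for u
  proof -
    have y: "0 \<le> (\<chi> i. - ln (u $ i)) $ i" for i using u by simp
    show ?thesis using cdf_P[OF y] rep[OF y] u by simp
  qed
  have le1: "AE x in P. \<forall>i. x $ i \<le> 1"
  proof -
    define e :: "real^'n" where "e = (\<chi> i. 1)"
    have "measure P {x. \<forall>i. x $ i \<le> e $ i} = exp (- h (\<chi> i. - ln (e $ i)))"
      by (rule C) (auto simp: e_def)
    \<comment> \<open>The zero vector, written as an axis vector so that
      \<open>support_fun_axis\<close> evaluates h there.\<close>
    also have "(\<chi> i. - ln (e $ i)) = axis undefined 0"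
      by (simp add: vec_eq_iff axis_def e_def)
    also have "h \<dots> = 0" unfolding h_def by (rule support_fun_axis[OF K]) simp
    finally have "measure P {x. \<forall>i. x $ i \<le> 1} = 1" by (simp add: e_def)
    moreover have "{x. \<forall>i. x $ i \<le> 1} \<in> P.events" by measurable
    ultimately have "AE x in P. x \<in> {x. \<forall>i. x $ i \<le> 1}" using P.prob_eq_1 by blast
    thus ?thesis by simp
  qed
  have marg_pos: "measure P {x. x $ i \<le> t} = t" if t: "0 < t" "t \<le> 1" for i t
  proof -
    \<comment> \<open>A coordinate 1 imposes no constraint almost surely, by \<open>le1\<close>, and
      its logarithm is 0, which leaves a vector on an axis.\<close>
    define u :: "real^'n" where "u = (\<chi> j. if j = i then t else 1)"
    have "measure P {x. x $ i \<le> t} = measure P {x. \<forall>j. x $ j \<le> u $ j}"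
    proof (rule P.finite_measure_eq_AE)
      show "AE x in P. x \<in> {x. x $ i \<le> t} \<longleftrightarrow> x \<in> {x. \<forall>j. x $ j \<le> u $ j}"
        using le1 by eventually_elim (auto simp: u_def)
    qed measurable
    also have "\<dots> = exp (- h (\<chi> i. - ln (u $ i)))" by (rule C) (use t in \<open>auto simp: u_def\<close>)
    also have "(\<chi> i. - ln (u $ i)) = axis i (- ln t)"
      by (auto simp: vec_eq_iff axis_def u_def)
    also have "h \<dots> = - ln t" unfolding h_def by (rule support_fun_axis[OF K]) (use t in simp)
    finally show ?thesis using t by simp
  qed
  have marg_nonpos: "measure P {x. x $ i \<le> t} = 0" if t: "t \<le> 0" for i t
  proof -
    \<comment> \<open>The logarithmic formula stops at positive levels, so level 0 is reached by
      monotonicity, squeezing with small positive levels.\<close>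
    have le: "measure P {x. x $ i \<le> t} \<le> \<epsilon>" if \<epsilon>: "0 < \<epsilon>" "\<epsilon> \<le> 1" for \<epsilon>
    proof -
      have "measure P {x. x $ i \<le> t} \<le> measure P {x. x $ i \<le> \<epsilon>}"
        by (rule P.finite_measure_mono) (use t \<epsilon> in auto)
      thus ?thesis using marg_pos[OF \<epsilon>] by simp
    qed
    show ?thesis
    proof (rule ccontr)
      assume "measure P {x. x $ i \<le> t} \<noteq> 0"
      hence "0 < measure P {x. x $ i \<le> t}" by (simp add: zero_less_measure_iff)
      thus False using le[of "min 1 (measure P {x. x $ i \<le> t} / 2)"] by auto
    qed
  qed
  have marg: "distr P borel (\<lambda>x. x $ i) = uniform_measure lborel {0..1}" for i
  proof (rule cdf_unique)
    show "real_distribution (distr P borel (\<lambda>x. x $ i))"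
      by (rule P.real_distribution_distr) measurable
    have "prob_space (uniform_measure lborel {0..1::real})"
      by (rule prob_space_uniform_measure) auto
    thus "real_distribution (uniform_measure lborel {0..1})"
      by (simp add: real_distribution_def real_distribution_axioms_def)
    show "cdf (distr P borel (\<lambda>x. x $ i)) = cdf (uniform_measure lborel {0..1})"
    proof
      fix t :: real
      have "cdf (distr P borel (\<lambda>x. x $ i)) t = measure P {x. x $ i \<le> t}"
        unfolding cdf_def by (subst measure_distr) (auto simp: vimage_def)
      also have "\<dots> = max 0 (min 1 t)"
      proof (cases "t > 1")
        case True
        have "measure P {x. x $ i \<le> t} = 1"
          using marg_pos[of 1 i] P.finite_measure_mono[of "{x. x $ i \<le> 1}" "{x. x $ i \<le> t}"] True
            P.prob_le_1[of "{x. x $ i \<le> t}"] by force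
        thus ?thesis using True by simp
      next
        case False
        thus ?thesis using marg_pos[of t i] marg_nonpos[of t i] by (cases "t > 0") auto
      qed
      also have "\<dots> = cdf (uniform_measure lborel {0..1}) t"
      proof -
        have "{0..1} \<inter> {..t} = {0..min 1 t}" by auto
        thus ?thesis unfolding cdf_def by (subst measure_uniform_measure) auto
      qed
      finally show "cdf (distr P borel (\<lambda>x. x $ i)) t = cdf (uniform_measure lborel {0..1}) t" .
    qed
  qed
  show ?thesis
    unfolding is_copula_def
  proof (intro exI[of _ P] conjI ballI allI)
    fix u :: "real^'n" assume u: "u \<in> unit_cube"
    show "(if \<exists>i. u $ i = 0 then 0 else exp (- support_fun K (\<chi> i. - ln (u $ i))))
        = measure P {x. \<forall>i. x $ i \<le> u $ i}"
    proof (cases "\<exists>i. u $ i = 0")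
      case True
      then obtain i where i: "u $ i = 0" by blast
      have "measure P {x. \<forall>i. x $ i \<le> u $ i} \<le> measure P {x. x $ i \<le> 0}"
        by (rule P.finite_measure_mono) (use i in \<open>auto, metis\<close>)
      thus ?thesis using True marg_nonpos[of 0 i] by (simp add: measure_le_0_iff)
    next
      case False
      hence "0 < u $ i" "u $ i \<le> 1" for i
        using u by (auto simp: unit_cube_def less_le)
      thus ?thesis using False C[of u] by (simp add: h_def)
    qed
  qed (use P marg in auto)
qed

text \<open>Homogeneity and positivity of h feed the spectral representation. The tilted measures
  were normalised to probabilities, and the factor h(1,...,1) lost there becomes part of the weight
  when the measure is moved to the sphere.\<close>

lemma max_zonoid_of_copula:
  fixes K :: "(real^'n) set"
  assumes N: "is_norm_fun N" and "compact K" "convex K"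
    and K: "convex hull (insert 0 (range (\<lambda>i. axis i 1))) \<subseteq> K" "K \<subseteq> unit_cube"
    and "is_copula (\<lambda>u. if (\<exists>i. u $ i = 0) then 0
                        else exp (- support_fun K (\<chi> i. - ln (u $ i))))"
  shows "max_zonoid N K"
proof -
  define h where "h = support_fun K"
  obtain P :: "(real^'n) measure" where P: "prob_space P" "sets P = sets borel"
    "\<And>i. distr P borel (\<lambda>x. x $ i) = uniform_measure lborel {0..1}"
    and C: "\<And>u. u \<in> unit_cube \<Longrightarrow> (if (\<exists>i. u $ i = 0) then 0
                  else exp (- h (\<chi> i. - ln (u $ i)))) = measure P {x. \<forall>i. x $ i \<le> u $ i}"
    using assms(6) unfolding is_copula_def h_def by blast
  \<comment> \<open>The substitution u = exp(-y) never produces a zero coordinate, so the default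
    value 0 of C does not interfere.\<close>
  have cdf_P: "measure P {x. \<forall>i. x $ i \<le> exp (- (y $ i))} = exp (- h y)"
    if "\<And>i. 0 \<le> y $ i" for y
    using C[of "\<chi> i. exp (- (y $ i))"] that by (simp add: unit_cube_def)
  have hom: "h (t *\<^sub>R y) = t * h y" if "\<And>i. 0 \<le> y $ i" "0 \<le> t" for t y
    unfolding h_def by (rule support_fun_scaleR[OF K that])
  have pos: "0 < h y" if "\<And>i. 0 \<le> y $ i" "y \<noteq> 0" for y
    unfolding h_def by (rule support_fun_pos[OF K that])
  obtain \<nu> :: "(real^'n) measure" where \<nu>: "prob_space \<nu>" "sets \<nu> = sets borel"
    "AE a in \<nu>. \<forall>i. 0 \<le> a $ i \<and> a $ i \<le> 2"
    and h_eq: "\<And>y. (\<And>i. 0 \<le> y $ i) \<Longrightarrow> h y = h (\<chi> i. 1) * (\<integral>a. weighted_max a y \<partial>\<nu>)"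
    by (rule spectral_measure_of_copula[OF P cdf_P hom pos]) blast+
  have he: "0 < h (\<chi> i. 1)" by (rule pos) (auto simp: vec_eq_iff)
  obtain \<sigma> :: "(real^'n) measure" where \<sigma>: "sets \<sigma> = sets borel" "finite_measure \<sigma>"
    and supp: "AE a in \<sigma>. a \<in> pos_sphere N"
    and int: "\<And>y. (\<And>i. 0 \<le> y $ i) \<Longrightarrow> integrable \<sigma> (\<lambda>a. weighted_max a y)"
    and eq: "\<And>y. (\<integral>a. weighted_max a y \<partial>\<sigma>) = h (\<chi> i. 1) * (\<integral>a. weighted_max a y \<partial>\<nu>)"
    by (rule spectral_measure_on_sphere[OF N \<nu> he]) blast
  have [measurable]: "N \<in> borel_measurable borel"
    by (rule borel_measurable_continuous_onI) (rule norm_fun_continuous[OF N])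
  have sphere: "pos_sphere N \<in> sets \<sigma>"
    unfolding \<sigma>(1) pos_sphere_def by measurable
  have [simp]: "space \<sigma> = UNIV" using sets_eq_imp_space_eq[OF \<sigma>(1)] by simp
  have rep: "h y = (\<integral>a. weighted_max a y \<partial>\<sigma>)" if "\<And>i. 0 \<le> y $ i" for y
    using h_eq[OF that] eq by simp
  \<comment> \<open>If the sphere were null, \<open>supp\<close> would make the whole measure
    vanish, against h(1,...,1) > 0.\<close>
  have "emeasure \<sigma> (pos_sphere N) \<noteq> 0"
  proof
    assume "emeasure \<sigma> (pos_sphere N) = 0"
    hence "AE a in \<sigma>. a \<notin> pos_sphere N"
      using sphere by (intro AE_not_in) (auto simp: null_sets_def)
    with supp have "AE a in \<sigma>. weighted_max a (\<chi> i. 1) = 0" by eventually_elim simp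
    hence "(\<integral>a. weighted_max a (\<chi> i. 1) \<partial>\<sigma>) = 0" by (rule integral_eq_zero_AE)
    thus False using he rep[of "\<chi> i. 1"] by simp
  qed
  moreover have "emeasure \<sigma> (UNIV - pos_sphere N) = 0"
  proof -
    have "UNIV - pos_sphere N = {a \<in> space \<sigma>. \<not> a \<in> pos_sphere N}" by auto
    moreover have "\<dots> \<in> sets \<sigma>" using sets.compl_sets[OF sphere] by (simp add: Compl_eq_Diff_UNIV[symmetric] Compl_eq)
    ultimately show ?thesis using supp by (simp add: AE_iff_measurable)
  qed
  moreover have "K \<subseteq> {x. \<forall>i. 0 \<le> x $ i}" using K(2) by (auto simp: unit_cube_def)
  ultimately show ?thesis
    unfolding max_zonoid_def using assms(2,3) \<sigma> int rep
    unfolding weighted_max_def h_def by blast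
qed

theorem theorem5p1:
  fixes K :: "(real^'n) set" and N :: "real^'n \<Rightarrow> real"
  assumes "is_norm_fun N"
    and "compact K" and "convex K"
    and "convex hull (insert 0 (range (\<lambda>i. axis i 1))) \<subseteq> K"
    and "K \<subseteq> unit_cube"
  shows "is_copula (\<lambda>u. if (\<exists>i. u $ i = 0) then 0
                        else exp (- support_fun K (\<chi> i. - ln (u $ i))))
         \<longleftrightarrow> max_zonoid N K"
  using assms copula_of_max_zonoid[of K N] max_zonoid_of_copula[of N K] by blast

end
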